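(* For every integer $m>1$ there exists a pair consisting of an $m$-dimensional real analytic manifold $X_{m,1}\subset\mathbb{R}^{m+2}$ and an $m$-dimensional smooth compact submanifold $X_{m,2}\subset\mathbb{R}^{m+2}$ such that the following hold, where $\pi_{m+2,1}:\mathbb{R}^{m+2}\to\mathbb{R}$ is the projection to the first coordinate. (1) $X_{m,1}$ is diffeomorphic to $\mathbb{R}^m$ and $X_{m,2}$ is diffeomorphic to $S^m$. (2) The Reeb digraphs of the functions $\pi_{m+2,1}|_{X_{m,1}}$ and $\pi_{m+2,1}|_{X_{m,2}}$ are defined. (3) The function $\pi_{m+2,1}|_{X_{m,2}}$ is a compactification of the function $\pi_{m+2,1}|_{X_{m,1}}$ in the smooth category. (4) The Reeb digraph of $\pi_{m+2,1}|_{X_{m,2}}$ is ${\rm ReebDC}(\pi_{m+2,1}|_{X_{m,1}},\pi_{m+2,1}|_{X_{m,2}},\phi_X,\phi_Y)$ for some pair $(\phi_X:X_{m,1}\to X_{m,2},\ \phi_Y:\mathbb{R}\to\mathbb{R})$ of an embedding $\phi_X$ and the identity map $\phi_Y$. In addition, ${\rm ReebDC}(\pi_{m+2,1}|_{X_{m,1}},\pi_{m+2,1}|_{X_{m,2}},\phi_X,\phi_Y)$ and the Reeb digraph of $\pi_{m+2,1}|_{X_{m,1}}$ are not isomorphic.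
   Context: **Real analytic manifolds.** An $m$-dimensional real analytic manifold $M\subset\mathbb{R}^{m+k}$ means a union of connected components of the zero set of a real analytic map $e:\mathbb{R}^{m+k}\to\mathbb{R}^k$ having no singular point on $M$ (the differential of $e$ has rank $k$ at every point of $M$). **Reeb spaces.** Let $Y=\mathbb{R}$ or $Y=S^1$ (the unit circle) and let $c:X\to Y$ be continuous. Write $x_1\sim_c x_2$ if $x_1,x_2$ lie in the same connected component of some preimage $c^{-1}(y)$. The Reeb space is $R_c:=X/{\sim_c}$, with quotient map $q_c:X\to R_c$ and the unique continuous map $\bar c:R_c\to Y$ with $c=\bar c\circ q_c$. For differentiable $c$, $S(c)\subset X$ is the set of its critical (singular) points. **Pre-digraphs.** A pre-digraph is a triplet $(G,S_G,c_G:G\to Y)$, $Y=\mathbb{R}$ or $S^1$, with $G$ a connected Hausdorff space, $c_G$ continuous, $S_G\subset G$ closed, and $G-S_G$ a disjoint union $\bigsqcup_{j\in J_G}e_{G,j}$ of copies $e_{G,j}$ of $\mathbb{R}$, such that taking the $e_{G,j}$ as $1$-cells and the points of $S_G$ as $0$-cells makes $G$ a (at most) $1$-dimensional cell complex (the closure of each $e_{G,j}$ is the union of $e_{G,j}$ and some points of $S_G$; no finiteness or weak-topology condition is required), and such that each $c_G|_{e_{G,j}}$ is injective. Each $e_{G,j}$ is oriented via $c_G$ from the orientation of $Y$ ($\mathbb{R}$ by its order, $S^1$ counterclockwise). An isomorphism between pre-digraphs $(G,S_G,c_G)$ and $(G',S_{G'},c_{G'})$ is a homeomorphism $G\to G'$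 mapping $S_G$ onto $S_{G'}$ and mapping the $1$-cells onto $1$-cells, preserving their orientations. **Reeb digraphs.** The Reeb digraph of $c:X\to Y$ is $(R_c,q_c(S(c)),\bar c)$; it is defined if this triplet is a pre-digraph. **Compactifications.** Let $\mathcal{C}$ be a category such as the smooth, real algebraic, real analytic or topological one, and let $\mathcal{C}'$ be a category obtained from $\mathcal{C}$ by a forgetful functor. For a map $c:X\to Y$ in $\mathcal{C}$, let $\phi_X:X\to X_0$ and $\phi_Y:Y\to Y_0$ be embeddings in $\mathcal{C}$ with $\phi_X(X)$ dense in a compact connected space $X_0$ and $\phi_Y(Y)$ dense in a connected space $Y_0$. A map $c_0:X_0\to Y_0$ in $\mathcal{C}'$ with $c_0\circ\phi_X=\phi_Y\circ c$ is a compactification of $c$ in $\mathcal{C}'$. **Reeb-D-C.** Suppose that the Reeb digraph of $c:X\to Y$ is defined and that $c_0:X_0\to Y_0$, with $Y_0=\mathbb{R}$ or $S^1$, is a compactification of $c$ in the topological category, with embeddings $\phi_X,\phi_Y$. If $(R_{c_0},\,q_{c_0}(\phi_X(S(c))\cup(X_0-\phi_X(X))),\,\bar{c_0})$ is a pre-digraph, it is called a Reeb digraph compactification (Reeb-D-C) of $c$ and is denoted by ${\rm ReebDC}(c,c_0,\phi_X,\phi_Y)$. *)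

theory Defs
  imports "HOL-Analysis.Analysis"
begin

section \<open>Smooth and real analytic maps between Euclidean spaces\<close>

text \<open>The set \<open>U\<close> is meant to be open in the next three definitions.\<close>

primrec Ck_on :: "nat \<Rightarrow> 'a::euclidean_space set \<Rightarrow> ('a \<Rightarrow> 'b::euclidean_space) \<Rightarrow> bool" where
  "Ck_on 0 U f \<longleftrightarrow> continuous_on U f"
| "Ck_on (Suc k) U f \<longleftrightarrow> (\<forall>x\<in>U. f differentiable (at x)) \<and>
     (\<forall>v. Ck_on k U (\<lambda>x. frechet_derivative f (at x) v))"

definition smooth_on :: "'a::euclidean_space set \<Rightarrow> ('a \<Rightarrow> 'b::euclidean_space) \<Rightarrow> bool" where
  "smooth_on U f \<longleftrightarrow> (\<forall>k. Ck_on k U f)"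

text \<open>Local convergent power series in the coordinates; the multi-indices are the functions
  \<open>\<alpha> : Basis \<Rightarrow> nat\<close>, made extensional so that each occurs exactly once in the sum.\<close>

definition real_analytic_on :: "'a::euclidean_space set \<Rightarrow> ('a \<Rightarrow> 'b::euclidean_space) \<Rightarrow> bool" where
  "real_analytic_on U f \<longleftrightarrow>
     (\<forall>x\<in>U. \<exists>r>0. \<exists>a :: ('a \<Rightarrow> nat) \<Rightarrow> 'b. \<forall>y\<in>ball x r.
        ((\<lambda>\<alpha>. (\<Prod>b\<in>Basis. ((y - x) \<bullet> b) ^ \<alpha> b) *\<^sub>R a \<alpha>) has_sum f y)
          (Basis \<rightarrow>\<^sub>E (UNIV :: nat set)))"


section \<open>Submanifolds of Euclidean spaces\<close>

text \<open>The type argument is the codomain \<open>\<real>\<^sup>k\<close> of the defining map, \<open>k = DIM('b)\<close>.\<close>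

definition real_analytic_manifold ::
    "'b::euclidean_space itself \<Rightarrow> nat \<Rightarrow> 'a::euclidean_space set \<Rightarrow> bool" where
  "real_analytic_manifold TYPE('b) m M \<longleftrightarrow>
     DIM('a) = m + DIM('b) \<and>
     (\<exists>e :: 'a \<Rightarrow> 'b. real_analytic_on UNIV e \<and>
        (\<exists>\<C>. \<C> \<subseteq> components {x. e x = 0} \<and> M = \<Union>\<C>) \<and>
        (\<forall>x\<in>M. dim (range (frechet_derivative e (at x))) = DIM('b)))"

text \<open>Slice charts.\<close>

definition smooth_submanifold :: "nat \<Rightarrow> 'a::euclidean_space set \<Rightarrow> bool" where
  "smooth_submanifold m M \<longleftrightarrow>
     (\<forall>p\<in>M. \<exists>U V \<phi> \<psi> L. open U \<and> p \<in> U \<and> open (V :: 'a set) \<and>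
        homeomorphism U V \<phi> \<psi> \<and> smooth_on U \<phi> \<and> smooth_on V \<psi> \<and>
        subspace L \<and> dim L = m \<and> \<phi> ` (U \<inter> M) = V \<inter> L)"

definition smooth_local_extension ::
    "'a::euclidean_space set \<Rightarrow> ('a \<Rightarrow> 'b::euclidean_space) \<Rightarrow> 'a \<Rightarrow> ('a \<Rightarrow> 'b) \<Rightarrow> bool" where
  "smooth_local_extension M f p g \<longleftrightarrow>
     (\<exists>U. open U \<and> p \<in> U \<and> smooth_on U g \<and> (\<forall>x\<in>U \<inter> M. g x = f x))"

definition smooth_map_on :: "'a::euclidean_space set \<Rightarrow> ('a \<Rightarrow> 'b::euclidean_space) \<Rightarrow> bool" where
  "smooth_map_on M f \<longleftrightarrow> (\<forall>p\<in>M. \<exists>g. smooth_local_extension M f p g)"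

definition diffeomorphic :: "'a::euclidean_space set \<Rightarrow> 'b::euclidean_space set \<Rightarrow> bool" where
  "diffeomorphic M N \<longleftrightarrow>
     (\<exists>f g. homeomorphism M N f g \<and> smooth_map_on M f \<and> smooth_map_on N g)"

text \<open>Velocities at \<open>p\<close> of smooth curves in \<open>M\<close>.\<close>

definition tangent_space :: "'a::euclidean_space set \<Rightarrow> 'a \<Rightarrow> 'a set" where
  "tangent_space M p =
     {v. \<exists>\<gamma> \<epsilon>. 0 < \<epsilon> \<and> smooth_on {-\<epsilon><..<\<epsilon>} \<gamma> \<and> \<gamma> ` {-\<epsilon><..<\<epsilon>} \<subseteq> M \<and> \<gamma> 0 = p \<and>
           (\<gamma> has_vector_derivative v) (at (0::real))}"

text \<open>The differential at \<open>p\<close> of a smooth map on \<open>M\<close>. It is to be applied to tangent vectors only: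
  there its value does not depend on the chosen extension.\<close>

definition differential ::
    "'a::euclidean_space set \<Rightarrow> ('a \<Rightarrow> 'b::euclidean_space) \<Rightarrow> 'a \<Rightarrow> 'a \<Rightarrow> 'b" where
  "differential M f p = frechet_derivative (SOME g. smooth_local_extension M f p g) (at p)"

definition critical_points :: "'a::euclidean_space set \<Rightarrow> ('a \<Rightarrow> real) \<Rightarrow> 'a set" where
  "critical_points M c = {p \<in> M. differential M c p ` tangent_space M p \<noteq> UNIV}"

definition smooth_embedding ::
    "'a::euclidean_space set \<Rightarrow> 'b::euclidean_space set \<Rightarrow> ('a \<Rightarrow> 'b) \<Rightarrow> bool" where
  "smooth_embedding M N f \<longleftrightarrow>
     smooth_map_on M f \<and>
     (\<forall>p\<in>M. inj_on (differential M f p) (tangent_space M p)) \<and>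
     embedding_map (top_of_set M) (top_of_set N) f"


section \<open>Reeb spaces\<close>

definition reeb_rel :: "'a topology \<Rightarrow> ('a \<Rightarrow> real) \<Rightarrow> 'a \<Rightarrow> 'a \<Rightarrow> bool" where
  "reeb_rel X c x1 x2 \<longleftrightarrow>
     (\<exists>y. connected_component_of (subtopology X {x \<in> topspace X. c x = y}) x1 x2)"

definition reeb_quotient :: "'a topology \<Rightarrow> ('a \<Rightarrow> real) \<Rightarrow> 'a \<Rightarrow> 'a set" where
  "reeb_quotient X c x = {x'. reeb_rel X c x x'}"

definition reeb_space :: "'a topology \<Rightarrow> ('a \<Rightarrow> real) \<Rightarrow> 'a set topology" where
  "reeb_space X c = topology (\<lambda>W. W \<subseteq> reeb_quotient X c ` topspace X \<and>
     openin X {x \<in> topspace X. reeb_quotient X c x \<in> W})"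

lemma openin_reeb_space:
  "openin (reeb_space X c) W \<longleftrightarrow> W \<subseteq> reeb_quotient X c ` topspace X \<and>
     openin X {x \<in> topspace X. reeb_quotient X c x \<in> W}"
proof -
  let ?q = "reeb_quotient X c"
  let ?P = "\<lambda>W. W \<subseteq> ?q ` topspace X \<and> openin X {x \<in> topspace X. ?q x \<in> W}"
  have "istopology ?P"
    unfolding istopology_def
  proof (intro conjI allI impI)
    fix S T assume "?P S" "?P T"
    moreover have "{x \<in> topspace X. ?q x \<in> S \<inter> T} =
        {x \<in> topspace X. ?q x \<in> S} \<inter> {x \<in> topspace X. ?q x \<in> T}"
      by blast
    ultimately show "S \<inter> T \<subseteq> ?q ` topspace X" "openin X {x \<in> topspace X. ?q x \<in> S \<inter> T}"
      by auto
  next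
    fix \<K> assume "\<forall>K\<in>\<K>. ?P K"
    moreover have "{x \<in> topspace X. ?q x \<in> \<Union>\<K>} = (\<Union>K\<in>\<K>. {x \<in> topspace X. ?q x \<in> K})"
      by blast
    ultimately show "\<Union>\<K> \<subseteq> ?q ` topspace X" "openin X {x \<in> topspace X. ?q x \<in> \<Union>\<K>}"
      by auto
  qed
  then show ?thesis
    by (simp add: reeb_space_def)
qed

lemma quotient_map_reeb_quotient: "quotient_map X (reeb_space X c) (reeb_quotient X c)"
proof -
  let ?q = "reeb_quotient X c"
  have "{x \<in> topspace X. ?q x \<in> ?q ` topspace X} = topspace X"
    by blast
  then have "openin (reeb_space X c) (?q ` topspace X)"
    by (simp add: openin_reeb_space)
  then have "topspace (reeb_space X c) = ?q ` topspace X"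
    by (meson openin_reeb_space openin_subset openin_topspace subset_antisym)
  then show ?thesis
    by (auto simp: quotient_map_def openin_reeb_space)
qed

text \<open>The map induced on the Reeb space: \<open>c\<close> is constant on each class.\<close>

definition reeb_induced :: "('a \<Rightarrow> real) \<Rightarrow> 'a set \<Rightarrow> real" where
  "reeb_induced c C = the_elem (c ` C)"

lemma reeb_induced_quotient:
  assumes "x \<in> topspace X"
  shows "reeb_induced c (reeb_quotient X c x) = c x"
proof -
  have "c x' = c x" if r: "reeb_rel X c x x'" for x'
    using connected_component_in_topspace r unfolding reeb_rel_def by fastforce
  moreover have "reeb_rel X c x x"
    unfolding reeb_rel_def using assms by (auto simp: connected_component_of_refl)
  ultimately have "c ` reeb_quotient X c x = {c x}"
    unfolding reeb_quotient_def by blast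
  then show ?thesis
    by (simp add: reeb_induced_def)
qed


section \<open>Pre-digraphs over the real line\<close>

type_synonym 'g graph_triple = "'g topology \<times> 'g set \<times> ('g \<Rightarrow> real)"

text \<open>If \<open>G - S\<close> is a disjoint union (as a space) of copies of \<open>\<real>\<close>, then these copies are its
  connected components. Conversely, the components form such a decomposition iff each of them is
  open in \<open>G - S\<close>, equivalently in \<open>G\<close>, and homeomorphic to \<open>\<real>\<close>.\<close>

definition one_cells :: "'g topology \<Rightarrow> 'g set \<Rightarrow> 'g set set" where
  "one_cells G S = connected_components_of (subtopology G (topspace G - S))"

fun pre_digraph :: "'g graph_triple \<Rightarrow> bool" where
  "pre_digraph (G, S, c) \<longleftrightarrow>
     connected_space G \<and> Hausdorff_space G \<and>
     continuous_map G euclideanreal c \<and>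
     closedin G S \<and>
     (\<forall>e\<in>one_cells G S.
        openin G e \<and>
        subtopology G e homeomorphic_space euclideanreal \<and>
        G closure_of e \<subseteq> e \<union> S \<and>
        inj_on c e)"

text \<open>As \<open>c\<close> is continuous and injective on a \<open>1\<close>-cell, the orientation of the cell is the linear
  order pulled back along \<open>c\<close>.\<close>

fun pre_digraph_isomorphic :: "'g graph_triple \<Rightarrow> 'h graph_triple \<Rightarrow> bool" where
  "pre_digraph_isomorphic (G, S, c) (G', S', c') \<longleftrightarrow>
     (\<exists>h. homeomorphic_map G G' h \<and> h ` S = S' \<and>
        (\<lambda>e. h ` e) ` one_cells G S = one_cells G' S' \<and>
        (\<forall>e\<in>one_cells G S. \<forall>x\<in>e. \<forall>y\<in>e. c x < c y \<longleftrightarrow> c' (h x) < c' (h y)))"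

definition reeb_digraph ::
    "'a::euclidean_space set \<Rightarrow> ('a \<Rightarrow> real) \<Rightarrow> 'a set graph_triple" where
  "reeb_digraph X c =
     (reeb_space (top_of_set X) c,
      reeb_quotient (top_of_set X) c ` critical_points X c,
      reeb_induced c)"

definition reeb_digraph_defined :: "'a::euclidean_space set \<Rightarrow> ('a \<Rightarrow> real) \<Rightarrow> bool" where
  "reeb_digraph_defined X c \<longleftrightarrow> pre_digraph (reeb_digraph X c)"


section \<open>Compactifications\<close>

definition topological_compactification ::
    "'a::euclidean_space set \<Rightarrow> 'c::euclidean_space set \<Rightarrow> ('a \<Rightarrow> 'c) \<Rightarrow>
     'b::euclidean_space set \<Rightarrow> 'd::euclidean_space set \<Rightarrow> ('b \<Rightarrow> 'd) \<Rightarrow>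
     ('a \<Rightarrow> 'b) \<Rightarrow> ('c \<Rightarrow> 'd) \<Rightarrow> bool" where
  "topological_compactification X Y c X0 Y0 c0 \<phi>X \<phi>Y \<longleftrightarrow>
     continuous_on X c \<and> c ` X \<subseteq> Y \<and>
     continuous_on X0 c0 \<and> c0 ` X0 \<subseteq> Y0 \<and>
     embedding_map (top_of_set X) (top_of_set X0) \<phi>X \<and>
     embedding_map (top_of_set Y) (top_of_set Y0) \<phi>Y \<and>
     compact X0 \<and> connected X0 \<and> X0 \<subseteq> closure (\<phi>X ` X) \<and>
     connected Y0 \<and> Y0 \<subseteq> closure (\<phi>Y ` Y) \<and>
     (\<forall>x\<in>X. c0 (\<phi>X x) = \<phi>Y (c x))"

definition smooth_compactification ::
    "'a::euclidean_space set \<Rightarrow> 'c::euclidean_space set \<Rightarrow> ('a \<Rightarrow> 'c) \<Rightarrow>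
     'b::euclidean_space set \<Rightarrow> 'd::euclidean_space set \<Rightarrow> ('b \<Rightarrow> 'd) \<Rightarrow>
     ('a \<Rightarrow> 'b) \<Rightarrow> ('c \<Rightarrow> 'd) \<Rightarrow> bool" where
  "smooth_compactification X Y c X0 Y0 c0 \<phi>X \<phi>Y \<longleftrightarrow>
     topological_compactification X Y c X0 Y0 c0 \<phi>X \<phi>Y \<and>
     (\<exists>m. smooth_submanifold m X) \<and> (\<exists>m. smooth_submanifold m Y) \<and>
     (\<exists>m. smooth_submanifold m X0) \<and> (\<exists>m. smooth_submanifold m Y0) \<and>
     smooth_map_on X c \<and> smooth_map_on X0 c0 \<and>
     smooth_embedding X X0 \<phi>X \<and> smooth_embedding Y Y0 \<phi>Y"

text \<open>Source and target line are both \<open>\<real>\<close>. The triple does not involve \<open>\<phi>Y\<close>; only the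
  condition under which it is defined does.\<close>

definition reeb_DC ::
    "'a::euclidean_space set \<Rightarrow> ('a \<Rightarrow> real) \<Rightarrow> 'b::euclidean_space set \<Rightarrow> ('b \<Rightarrow> real) \<Rightarrow>
     ('a \<Rightarrow> 'b) \<Rightarrow> (real \<Rightarrow> real) \<Rightarrow> 'b set graph_triple" where
  "reeb_DC X c X0 c0 \<phi>X \<phi>Y =
     (reeb_space (top_of_set X0) c0,
      reeb_quotient (top_of_set X0) c0 ` (\<phi>X ` critical_points X c \<union> (X0 - \<phi>X ` X)),
      reeb_induced c0)"

definition reeb_DC_defined ::
    "'a::euclidean_space set \<Rightarrow> ('a \<Rightarrow> real) \<Rightarrow> 'b::euclidean_space set \<Rightarrow> ('b \<Rightarrow> real) \<Rightarrow>
     ('a \<Rightarrow> 'b) \<Rightarrow> (real \<Rightarrow> real) \<Rightarrow> bool" where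
  "reeb_DC_defined X c X0 c0 \<phi>X \<phi>Y \<longleftrightarrow>
     reeb_digraph_defined X c \<and>
     topological_compactification X UNIV c X0 UNIV c0 \<phi>X \<phi>Y \<and>
     pre_digraph (reeb_DC X c X0 c0 \<phi>X \<phi>Y)"

end

theory Submission
  imports Defs
begin

text \<open>Take for \<open>X\<^sub>2\<close> the unit sphere \<open>t\<^sup>2 + |y|\<^sup>2 = 1\<close> in the hyperplane \<open>s = 0\<close>, and for \<open>X\<^sub>1\<close> the graph of
  \<open>s = 1 / (1 - t)\<close> over this sphere without its pole \<open>t = 1\<close>. The graph is the closed algebraic set
  \<open>s (1 - t) = 1\<close>, \<open>t\<^sup>2 + |y|\<^sup>2 = 1\<close>: it escapes to infinity in the direction \<open>s\<close>, so the first
  coordinate stays bounded, and forgetting \<open>s\<close> compactifies it by the missing pole. All fibres of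
  \<open>t\<close> are connected since \<open>m > 1\<close>; hence the Reeb spaces are \<open>[-1, 1)\<close> and \<open>[-1, 1]\<close>, with one and
  two \<open>0\<close>-cells, respectively.\<close>

section \<open>Smooth maps\<close>

text \<open>The coordinate \<open>s\<close> does two jobs. It pushes the pole to infinity through an
  equation of degree 2, so analyticity amounts to a finite Taylor expansion. And
  \<open>1 / (1 - t)\<close> is exactly the factor of the stereographic projection, so the global
  chart of the graph is polynomial in the ambient coordinates. The removed pole is the maximum of
  \<open>t\<close>. It is therefore critical on the sphere, and adding it to the vertices of the
  graph gives precisely the vertices of the sphere, while the graph itself never sees it. Tangent
  vectors are velocities of curves, so a point is shown to be regular only by exhibiting curves
  through it. These are built once, on the graph, and carried to the sphere by the linear map
  \<open>flatten\<close>.\<close>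

lemma Ck_on_cong:
  assumes "open U" "\<And>x. x \<in> U \<Longrightarrow> f x = g x"
  shows "Ck_on k U f \<longleftrightarrow> Ck_on k U g"
  using assms(2)
proof (induction k arbitrary: f g)
  case 0
  then show ?case
    by (simp cong: continuous_on_cong)
next
  case (Suc k)
  have D: "(f has_derivative f') (at x) \<longleftrightarrow> (g has_derivative f') (at x)" if "x \<in> U" for x f'
    using that Suc.prems \<open>open U\<close> has_derivative_transform_within_open[of _ _ _ UNIV U]
    by metis
  have diff: "f differentiable (at x) \<longleftrightarrow> g differentiable (at x)" if "x \<in> U" for x
    using D[OF that] by (simp add: differentiable_def)
  have "frechet_derivative f (at x) = frechet_derivative g (at x)" if "x \<in> U" for x
    unfolding frechet_derivative_def using D[OF that] by simp
  then have "Ck_on k U (\<lambda>x. frechet_derivative f (at x) v) \<longleftrightarrow>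
      Ck_on k U (\<lambda>x. frechet_derivative g (at x) v)" for v
    by (intro Suc.IH) simp
  then show ?case
    using diff by simp
qed

text \<open>Lets a known derivative stand in for the choice operator
  \<open>frechet_derivative\<close> of the definition; the inductions below all go through this
  rule.\<close>

lemma Ck_on_SucI:
  assumes "open U" "\<And>x. x \<in> U \<Longrightarrow> (f has_derivative f' x) (at x)" "\<And>v. Ck_on k U (\<lambda>x. f' x v)"
  shows "Ck_on (Suc k) U f"
proof -
  have "Ck_on k U (\<lambda>x. frechet_derivative f (at x) v)" for v
    using assms(3)[of v] Ck_on_cong[OF \<open>open U\<close>, of "\<lambda>x. frechet_derivative f (at x) v"]
    by (metis assms(2) frechet_derivative_at)
  then show ?thesis
    using assms(2) by (auto simp: differentiable_def)
qed

lemma Ck_on_SucD: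
  assumes "Ck_on (Suc k) U f" "x \<in> U"
  shows "(f has_derivative frechet_derivative f (at x)) (at x)"
  using assms by (simp add: frechet_derivative_works)

lemma Ck_on_Suc_imp:
  assumes "Ck_on (Suc k) U f"
  shows "Ck_on k U f"
  using assms
proof (induction k arbitrary: f)
  case 0
  then show ?case
    by (auto intro!: continuous_at_imp_continuous_on differentiable_imp_continuous_within)
qed auto

lemma Ck_on_const: "open U \<Longrightarrow> Ck_on k U (\<lambda>x. c)"
proof (induction k arbitrary: c)
  case (Suc k)
  then show ?case
    by (intro Ck_on_SucI[where f' = "\<lambda>_ _. 0"]) auto
qed simp

lemma Ck_on_bounded_linear_compose:
  assumes "bounded_linear L" "open U" "Ck_on k U f"
  shows "Ck_on k U (\<lambda>x. L (f x))"
  using assms(3)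
proof (induction k arbitrary: f)
  case 0
  then show ?case
    by (simp add: assms(1) bounded_linear.continuous_on)
next
  case (Suc k)
  show ?case
    by (rule Ck_on_SucI[OF \<open>open U\<close>,
        OF bounded_linear.has_derivative[OF assms(1) Ck_on_SucD[OF Suc.prems]]])
       (use Suc in auto)
qed

lemma Ck_on_add:
  assumes "open U" "Ck_on k U f" "Ck_on k U g"
  shows "Ck_on k U (\<lambda>x. f x + g x)"
  using assms(2,3)
proof (induction k arbitrary: f g)
  case 0
  then show ?case
    by (simp add: continuous_on_add)
next
  case (Suc k)
  show ?case
    by (rule Ck_on_SucI[OF \<open>open U\<close>,
        OF has_derivative_add[OF Ck_on_SucD[OF Suc.prems(1)] Ck_on_SucD[OF Suc.prems(2)]]])
       (use Suc in auto)
qed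

text \<open>One induction for products, scalings and inner products alike. The product rule pairs a
  derivative of one factor with the other factor itself, whose order therefore has to be lowered by
  \<open>Ck_on_Suc_imp\<close>.\<close>

lemma Ck_on_bilinear:
  assumes "bounded_bilinear B" "open U" "Ck_on k U f" "Ck_on k U g"
  shows "Ck_on k U (\<lambda>x. B (f x) (g x))"
  using assms(3,4)
proof (induction k arbitrary: f g)
  case 0
  then show ?case
    by (simp add: assms(1) bounded_bilinear.continuous_on)
next
  case (Suc k)
  show ?case
    by (rule Ck_on_SucI[OF \<open>open U\<close>, OF bounded_bilinear.FDERIV[OF assms(1)
          Ck_on_SucD[OF Suc.prems(1)] Ck_on_SucD[OF Suc.prems(2)]]])
       (use Suc Suc.prems[THEN Ck_on_Suc_imp] in \<open>auto intro!: Ck_on_add \<open>open U\<close>\<close>)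
qed

text \<open>The derivative of \<open>1 / f\<close> is made of \<open>1 / f\<close> and the
  derivative of \<open>f\<close>, so the induction hypothesis for \<open>1 / f\<close> at order
  \<open>k\<close> yields order \<open>k + 1\<close>.\<close>

lemma Ck_on_inverse:
  fixes f :: "'a::euclidean_space \<Rightarrow> real"
  assumes "open U" "\<And>x. x \<in> U \<Longrightarrow> f x \<noteq> 0" "Ck_on k U f"
  shows "Ck_on k U (\<lambda>x. inverse (f x))"
  using assms(3)
proof (induction k)
  case 0
  then show ?case
    using assms(2) by (auto intro: continuous_on_inverse)
next
  case (Suc k)
  have inv: "Ck_on k U (\<lambda>x. inverse (f x))"
    using Suc Ck_on_Suc_imp by blast
  \<comment> \<open>The sign is written as a factor so that the rule for products covers the whole
    expression.\<close>
  have "Ck_on k U (\<lambda>x. (- 1) * (inverse (f x) * frechet_derivative f (at x) v * inverse (f x)))" for v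
    using Suc.prems inv
    by (intro Ck_on_bilinear[OF bounded_bilinear_mult \<open>open U\<close>] Ck_on_const \<open>open U\<close>) auto
  then show ?case
    by (intro Ck_on_SucI[OF \<open>open U\<close>, OF Deriv.has_derivative_inverse[OF assms(2)
          Ck_on_SucD[OF Suc.prems]]]) auto
qed

section \<open>Closure properties of smooth maps\<close>

lemma smooth_on_const: "open U \<Longrightarrow> smooth_on U (\<lambda>x. c)"
  unfolding smooth_on_def using Ck_on_const by blast

lemma smooth_on_linear_compose:
  "bounded_linear L \<Longrightarrow> open U \<Longrightarrow> smooth_on U f \<Longrightarrow> smooth_on U (\<lambda>x. L (f x))"
  unfolding smooth_on_def using Ck_on_bounded_linear_compose by blast

lemma smooth_on_linear:
  assumes "bounded_linear L" "open U"
  shows "smooth_on U L"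
proof -
  have "Ck_on k U L" for k
  proof (cases k)
    case 0
    then show ?thesis
      by (simp add: assms(1) linear_continuous_on)
  next
    case (Suc j)
    then show ?thesis
      using Ck_on_SucI[OF \<open>open U\<close>, of L "\<lambda>_. L"] bounded_linear_imp_has_derivative[OF assms(1)]
        Ck_on_const[OF \<open>open U\<close>] by blast
  qed
  then show ?thesis
    by (simp add: smooth_on_def)
qed

lemma smooth_on_ident: "open U \<Longrightarrow> smooth_on U (\<lambda>x. x)"
  by (intro smooth_on_linear bounded_linear_ident)

lemma smooth_on_add:
  "open U \<Longrightarrow> smooth_on U f \<Longrightarrow> smooth_on U g \<Longrightarrow> smooth_on U (\<lambda>x. f x + g x)"
  unfolding smooth_on_def using Ck_on_add by blast

lemma smooth_on_bilinear:
  "bounded_bilinear B \<Longrightarrow> open U \<Longrightarrow> smooth_on U f \<Longrightarrow> smooth_on U g \<Longrightarrow>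
    smooth_on U (\<lambda>x. B (f x) (g x))"
  unfolding smooth_on_def using Ck_on_bilinear by blast

lemmas smooth_on_mult = smooth_on_bilinear[OF bounded_bilinear_mult]
  and smooth_on_scaleR = smooth_on_bilinear[OF bounded_bilinear_scaleR]
  and smooth_on_inner = smooth_on_bilinear[OF bounded_bilinear_inner]
  and smooth_on_fst = smooth_on_linear_compose[OF bounded_linear_fst]
  and smooth_on_snd = smooth_on_linear_compose[OF bounded_linear_snd]

lemma smooth_on_diff:
  assumes "open U" "smooth_on U f" "smooth_on U g"
  shows "smooth_on U (\<lambda>x. f x - g x)"
  using smooth_on_add[OF assms(1,2) smooth_on_linear_compose[OF
        bounded_linear_minus[OF bounded_linear_ident] assms(1,3)]] by simp

lemma smooth_on_Pair:
  fixes f :: "'a::euclidean_space \<Rightarrow> 'b::euclidean_space" and g :: "'a \<Rightarrow> 'c::euclidean_space"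
  assumes "open U" "smooth_on U f" "smooth_on U g"
  shows "smooth_on U (\<lambda>x. (f x, g x))"
proof -
  have "bounded_linear (\<lambda>y :: 'b. (y, 0 :: 'c))" "bounded_linear (\<lambda>y :: 'c. (0 :: 'b, y))"
    by (intro bounded_linear_Pair bounded_linear_ident bounded_linear_zero)+
  from this[THEN smooth_on_linear_compose, OF assms(1)] show ?thesis
    using smooth_on_add[OF assms(1), of "\<lambda>x. (f x, 0)" "\<lambda>x. (0, g x)"] assms(2,3)
    by simp
qed

lemma smooth_on_divide:
  fixes g :: "'a::euclidean_space \<Rightarrow> real"
  assumes "open U" "smooth_on U f" "smooth_on U g" "\<And>x. x \<in> U \<Longrightarrow> g x \<noteq> 0"
  shows "smooth_on U (\<lambda>x. f x / g x)"
proof -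
  have "smooth_on U (\<lambda>x. inverse (g x))"
    using assms Ck_on_inverse unfolding smooth_on_def by blast
  then show ?thesis
    using smooth_on_mult[OF assms(1,2)] by (simp add: divide_inverse)
qed

lemmas smooth_intros = smooth_on_const smooth_on_ident smooth_on_add smooth_on_diff smooth_on_mult
  smooth_on_scaleR smooth_on_inner smooth_on_fst smooth_on_snd smooth_on_Pair smooth_on_divide

lemma smooth_on_imp_differentiable: "smooth_on U f \<Longrightarrow> x \<in> U \<Longrightarrow> f differentiable (at x)"
  unfolding smooth_on_def by (metis Ck_on.simps(2))

lemma smooth_map_onI: "smooth_on U g \<Longrightarrow> open U \<Longrightarrow> M \<subseteq> U \<Longrightarrow> (\<And>x. x \<in> M \<Longrightarrow> g x = f x) \<Longrightarrow>
    smooth_map_on M f"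
  unfolding smooth_map_on_def smooth_local_extension_def by (metis IntD2 subsetD)

text \<open>A curve in \<open>M\<close> does not see which extension of \<open>f\<close> the choice operator in
  \<^const>\<open>differential\<close> picked.\<close>

lemma differential_tangent:
  assumes "smooth_map_on M f" "p \<in> M" "(f has_derivative f') (at p)" "v \<in> tangent_space M p"
  shows "differential M f p v = f' v"
proof -
  define g where "g = (SOME g. smooth_local_extension M f p g)"
  have "smooth_local_extension M f p g"
    unfolding g_def using assms(1,2) by (metis smooth_map_on_def someI_ex)
  then obtain U where U: "open U" "p \<in> U" "smooth_on U g" "\<And>x. x \<in> U \<inter> M \<Longrightarrow> g x = f x"
    unfolding smooth_local_extension_def by blast
  have g': "(g has_derivative frechet_derivative g (at p)) (at p)"
    using smooth_on_imp_differentiable[OF U(3,2)] by (simp add: frechet_derivative_works)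
  obtain \<gamma> \<epsilon> where \<gamma>: "0 < \<epsilon>" "\<gamma> ` {-\<epsilon><..<\<epsilon>} \<subseteq> M" "\<gamma> 0 = p"
      "(\<gamma> has_vector_derivative v) (at (0::real))"
    using assms(4) unfolding tangent_space_def by blast
  have \<gamma>': "(\<gamma> has_derivative (\<lambda>h. h *\<^sub>R v)) (at 0)"
    using \<gamma>(4) by (simp add: has_vector_derivative_def)
  have "isCont \<gamma> 0"
    using \<gamma>' has_derivative_continuous by blast
  then have "\<forall>\<^sub>F \<tau> in at 0. \<gamma> \<tau> \<in> U"
    using U(1,2) \<gamma>(3) by (simp add: isCont_def topological_tendstoD)
  moreover have "\<forall>\<^sub>F \<tau> in at 0. \<tau> \<in> {-\<epsilon><..<\<epsilon>}"
    using \<gamma>(1) by (intro eventually_at_in_open') auto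
  \<comment> \<open>Along the curve \<open>g\<close> and \<open>f\<close> agree near
    \<open>0\<close>. Hence their derivatives at \<open>p\<close> agree on \<open>v\<close>,
    although they may differ off the tangent space.\<close>
  ultimately have ev: "\<forall>\<^sub>F \<tau> in at 0. (g \<circ> \<gamma>) \<tau> = (f \<circ> \<gamma>) \<tau>"
  proof eventually_elim
    case (elim \<tau>)
    then show ?case using U(4)[of "\<gamma> \<tau>"] \<gamma>(2) by (auto simp: image_subset_iff)
  qed
  have "((g \<circ> \<gamma>) has_derivative (\<lambda>h. frechet_derivative g (at p) (h *\<^sub>R v))) (at 0)"
    using diff_chain_at[OF \<gamma>'] g' \<gamma>(3) by (simp add: o_def)
  moreover have "((f \<circ> \<gamma>) has_derivative (\<lambda>h. f' (h *\<^sub>R v))) (at 0)"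
    using diff_chain_at[OF \<gamma>'] assms(3) \<gamma>(3) by (simp add: o_def)
  moreover have "(g \<circ> \<gamma>) 0 = (f \<circ> \<gamma>) 0"
    using U(2,4) assms(2) \<gamma>(3) by simp
  ultimately have "((f \<circ> \<gamma>) has_derivative (\<lambda>h. frechet_derivative g (at p) (h *\<^sub>R v))) (at 0)"
    using has_derivative_transform_eventually[OF _ ev] by blast
  then have "(\<lambda>h. frechet_derivative g (at p) (h *\<^sub>R v)) = (\<lambda>h. f' (h *\<^sub>R v))"
    using \<open>((f \<circ> \<gamma>) has_derivative (\<lambda>h. f' (h *\<^sub>R v))) (at 0)\<close> has_derivative_unique by blast
  then have "frechet_derivative g (at p) (1 *\<^sub>R v) = f' (1 *\<^sub>R v)"
    by (rule fun_cong)
  then show ?thesis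
    by (simp add: differential_def g_def)
qed

section \<open>Quadratic maps are real analytic\<close>

text \<open>Expanding about \<open>x\<close> gives the constant \<open>f x\<close>, the linear part
  \<open>L h + (B x h + B h x)\<close> and the quadratic part \<open>B h h\<close>. Each is a finite
  sum of monomials in the coordinates of \<open>h\<close>. The predicate \<open>P\<close> collects
  the maps with a power series valid for every \<open>h\<close>; it is closed under sums.\<close>

lemma real_analytic_on_quadratic:
  fixes L :: "'a::euclidean_space \<Rightarrow> 'b::euclidean_space"
  assumes "linear L" "bilinear B"
  shows "real_analytic_on U (\<lambda>x. c + L x + B x x)"
  unfolding real_analytic_on_def
proof (intro ballI)
  fix x assume "x \<in> U"
  define f where "f = (\<lambda>x. c + L x + B x x)"
  let ?I = "Basis \<rightarrow>\<^sub>E (UNIV :: nat set)"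
  define mon where "mon = (\<lambda>h (\<alpha> :: 'a \<Rightarrow> nat). \<Prod>b\<in>Basis. (h \<bullet> b) ^ \<alpha> b)"
  \<comment> \<open>The multi-index of the monomial \<open>h \<bullet> i\<close>.\<close>
  define d where "d = (\<lambda>i b :: 'a. if b = i then 1 else 0 :: nat)"
  define P where "P = (\<lambda>g. \<exists>a :: ('a \<Rightarrow> nat) \<Rightarrow> 'b. \<forall>h.
      ((\<lambda>\<alpha>. mon h \<alpha> *\<^sub>R a \<alpha>) has_sum g h) ?I)"
  have P_add: "P (\<lambda>h. g1 h + g2 h)" if P12: "P g1" "P g2" for g1 g2
  proof -
    obtain a1 a2 where "\<And>h. ((\<lambda>\<alpha>. mon h \<alpha> *\<^sub>R a1 \<alpha>) has_sum g1 h) ?I"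
        "\<And>h. ((\<lambda>\<alpha>. mon h \<alpha> *\<^sub>R a2 \<alpha>) has_sum g2 h) ?I"
      using P12 unfolding P_def by blast
    then have "((\<lambda>\<alpha>. mon h \<alpha> *\<^sub>R (a1 \<alpha> + a2 \<alpha>)) has_sum g1 h + g2 h) ?I" for h
      using has_sum_add by (fastforce simp: scaleR_add_right)
    then show ?thesis
      unfolding P_def by (intro exI[of _ "\<lambda>\<alpha>. a1 \<alpha> + a2 \<alpha>"]) blast
  qed
  \<comment> \<open>The index set holds extensional functions only, so \<open>\<alpha>\<close> is
    represented by its restriction to \<open>Basis\<close>.\<close>
  have P_mon: "P (\<lambda>h. mon h \<alpha> *\<^sub>R w)" for \<alpha> w
  proof -
    have eq: "mon h (restrict \<alpha> Basis) = mon h \<alpha>" for h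
      unfolding mon_def by (intro prod.cong) auto
    have "((\<lambda>\<beta>. mon h \<beta> *\<^sub>R (if \<beta> = restrict \<alpha> Basis then w else 0)) has_sum mon h \<alpha> *\<^sub>R w) ?I" for h
      by (rule has_sum_finite_neutralI[where B = "{restrict \<alpha> Basis}"]) (auto simp: eq)
    then show ?thesis
      unfolding P_def by (intro exI[of _ "\<lambda>\<beta>. if \<beta> = restrict \<alpha> Basis then w else 0"]) blast
  qed
  have P_sum: "P (\<lambda>h. \<Sum>i\<in>A. g i h)" if "finite A" "\<And>i. i \<in> A \<Longrightarrow> P (g i)" for A and g :: "'a \<Rightarrow> _"
    using that
  proof (induction A rule: finite_induct)
    case empty
    then show ?case using P_mon[of "\<lambda>_. 0" 0] by simp
  next
    case (insert i A)
    then show ?case by (auto intro: P_add)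
  qed
  have mon1: "mon h (d i) = h \<bullet> i" if "i \<in> Basis" for h i
  proof -
    have "mon h (d i) = (\<Prod>b\<in>Basis. if b = i then h \<bullet> b else 1)"
      unfolding mon_def d_def by (intro prod.cong) auto
    then show ?thesis using that by simp
  qed
  have mon2: "mon h (\<lambda>b. d i b + d j b) = (h \<bullet> i) * (h \<bullet> j)" if "i \<in> Basis" "j \<in> Basis" for h i j
    using mon1[OF that(1), of h] mon1[OF that(2), of h]
    unfolding mon_def by (simp add: power_add prod.distrib)
  have lin: "P g" if "linear g" for g
  proof -
    have "g h = (\<Sum>i\<in>Basis. mon h (d i) *\<^sub>R g i)" for h
      using linear_sum[OF that, of "\<lambda>i. (h \<bullet> i) *\<^sub>R i" Basis]
      by (simp add: euclidean_representation mon1 linear_cmul[OF that] cong: sum.cong)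
    then have "g = (\<lambda>h. \<Sum>i\<in>Basis. mon h (d i) *\<^sub>R g i)" by blast
    moreover have "P \<dots>" by (intro P_sum P_mon) auto
    ultimately show ?thesis by simp
  qed
  have "B h h = (\<Sum>i\<in>Basis. \<Sum>j\<in>Basis. mon h (\<lambda>b. d i b + d j b) *\<^sub>R B i j)" for h
  proof -
    have "B h h = B (\<Sum>i\<in>Basis. (h \<bullet> i) *\<^sub>R i) (\<Sum>i\<in>Basis. (h \<bullet> i) *\<^sub>R i)"
      by (simp add: euclidean_representation)
    also have "\<dots> = (\<Sum>(i,j)\<in>Basis \<times> Basis. B ((h \<bullet> i) *\<^sub>R i) ((h \<bullet> j) *\<^sub>R j))"
      by (rule bilinear_sum[OF assms(2)])
    also have "\<dots> = (\<Sum>i\<in>Basis. \<Sum>j\<in>Basis. B ((h \<bullet> i) *\<^sub>R i) ((h \<bullet> j) *\<^sub>R j))"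
      by (simp add: sum.cartesian_product)
    also have "\<dots> = (\<Sum>i\<in>Basis. \<Sum>j\<in>Basis. mon h (\<lambda>b. d i b + d j b) *\<^sub>R B i j)"
      by (simp add: mon2 bilinear_lmul[OF assms(2)] bilinear_rmul[OF assms(2)] mult.commute cong: sum.cong)
    finally show ?thesis .
  qed
  then have quad: "P (\<lambda>h. B h h)"
    by (auto intro!: P_sum P_mon)
  have "linear (\<lambda>h. L h + (B x h + B h x))"
    using assms unfolding bilinear_def by (intro linear_compose_add) auto
  then have "P (\<lambda>h. mon h (\<lambda>_. 0) *\<^sub>R f x + (L h + (B x h + B h x)) + B h h)"
    by (intro P_add P_mon lin quad)
  moreover have "mon h (\<lambda>_. 0) *\<^sub>R f x + (L h + (B x h + B h x)) + B h h = f (x + h)" for h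
    by (simp add: f_def mon_def linear_add[OF assms(1)] bilinear_ladd[OF assms(2)]
        bilinear_radd[OF assms(2)])
  ultimately have "P (\<lambda>h. f (x + h))" by simp
  then obtain a where a: "\<And>h. ((\<lambda>\<alpha>. mon h \<alpha> *\<^sub>R a \<alpha>) has_sum f (x + h)) ?I"
    unfolding P_def by blast
  have "((\<lambda>\<alpha>. mon (y - x) \<alpha> *\<^sub>R a \<alpha>) has_sum f y) ?I" for y
    using a[of "y - x"] by simp
  then show "\<exists>r>0. \<exists>a. \<forall>y\<in>ball x r. ((\<lambda>\<alpha>. (\<Prod>b\<in>Basis. ((y - x) \<bullet> b) ^ \<alpha> b) *\<^sub>R a \<alpha>)
      has_sum c + L y + B y y) ?I"
    \<comment> \<open>The expansion holds everywhere, so any radius serves.\<close>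
    unfolding mon_def f_def by (intro exI[of _ 1]) auto
qed

section \<open>Reeb spaces of functions with connected fibres\<close>

text \<open>A connected fibre is itself the connected set that joins any two of its points, so the
  Reeb classes are entire fibres.\<close>

lemma reeb_rel_connected_fibres:
  assumes "\<And>t. connected {x \<in> X. c x = t}"
  shows "reeb_rel (top_of_set X) c x x' \<longleftrightarrow> x \<in> X \<and> x' \<in> X \<and> c x = c x'"
proof
  assume "reeb_rel (top_of_set X) c x x'"
  then show "x \<in> X \<and> x' \<in> X \<and> c x = c x'"
    unfolding reeb_rel_def by (auto dest: connected_component_in_topspace)
next
  assume "x \<in> X \<and> x' \<in> X \<and> c x = c x'"
  moreover have "X \<inter> {xa \<in> X. c xa = c x} = {xa \<in> X. c xa = c x}" by blast
  ultimately show "reeb_rel (top_of_set X) c x x'"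
    unfolding reeb_rel_def connected_component_of_def using assms[of "c x"]
    by (intro exI[of _ "c x"] exI[of _ "{xa \<in> X. c xa = c x}"])
       (auto simp: subtopology_subtopology connectedin_subtopology)
qed

text \<open>The induced map is a continuous bijection onto \<open>J\<close>. The graph is not
  compact, so continuity of the inverse is taken from a section \<open>s\<close> of
  \<open>c\<close>: the inverse is the quotient map after \<open>s\<close>.\<close>

lemma homeomorphic_maps_reeb_space:
  fixes c :: "'a::topological_space \<Rightarrow> real"
  assumes fibres: "\<And>t. connected {x \<in> X. c x = t}"
    and "continuous_on X c" "c ` X \<subseteq> J"
    and "continuous_on J s" "s ` J \<subseteq> X" "\<And>t. t \<in> J \<Longrightarrow> c (s t) = t"
  shows "homeomorphic_maps (reeb_space (top_of_set X) c) (top_of_set J) (reeb_induced c)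
    (\<lambda>t. reeb_quotient (top_of_set X) c (s t))"
proof -
  let ?X = "top_of_set X"
  let ?q = "reeb_quotient ?X c"
  note q = quotient_map_reeb_quotient[of ?X c]
  have c: "reeb_induced c (?q x) = c x" if "x \<in> X" for x
    using that by (simp add: reeb_induced_quotient)
  have "continuous_map ?X (top_of_set J) (reeb_induced c \<circ> ?q)"
    using assms(2,3) c by (auto simp: cong: continuous_on_cong)
  then have "continuous_map (reeb_space ?X c) (top_of_set J) (reeb_induced c)"
    using continuous_compose_quotient_map[OF q] by blast
  moreover have "continuous_map (top_of_set J) (reeb_space ?X c) (?q \<circ> s)"
    using assms(4,5) by (intro continuous_map_compose[OF _ quotient_imp_continuous_map[OF q]]) auto
  moreover have "?q (s (reeb_induced c C)) = C" if C: "C \<in> topspace (reeb_space ?X c)" for C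
  proof -
    have "topspace (reeb_space ?X c) = ?q ` X"
      using quotient_imp_surjective_map[OF q] by simp
    then obtain x where x: "x \<in> X" "C = ?q x"
      using C by blast
    then have "c (s (c x)) = c x" "s (c x) \<in> X"
      using assms(3,5,6) by auto
    then show ?thesis
      using x c by (simp add: reeb_quotient_def reeb_rel_connected_fibres[OF fibres])
  qed
  ultimately show ?thesis
    unfolding homeomorphic_maps_def using assms(5,6) c by (auto simp: o_def)
qed

text \<open>Everything is transported along the homeomorphism onto \<open>J\<close>. The vertices go
  to the critical values, and what remains of \<open>J\<close> is one open interval, hence one
  \<open>1\<close>-cell; injectivity of the induced map on it comes for free.\<close>

lemma pre_digraph_reeb_space:
  fixes c :: "'a::topological_space \<Rightarrow> real"
  assumes fibres: "\<And>t. connected {x \<in> X. c x = t}"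
    and "continuous_on X c" "c ` X \<subseteq> J"
    and "continuous_on J s" "s ` J \<subseteq> X" "\<And>t. t \<in> J \<Longrightarrow> c (s t) = t"
    and "connected J" "C \<subseteq> X" "J - c ` C = {a<..<b}" "a < b"
  shows "pre_digraph (reeb_space (top_of_set X) c, reeb_quotient (top_of_set X) c ` C, reeb_induced c)"
proof -
  let ?X = "top_of_set X"
  let ?q = "reeb_quotient ?X c"
  let ?G = "reeb_space ?X c"
  let ?S = "?q ` C"
  let ?f = "reeb_induced c"
  have hm: "homeomorphic_maps ?G (top_of_set J) ?f (\<lambda>t. ?q (s t))"
    by (rule homeomorphic_maps_reeb_space[OF assms(1-6)])
  then have f: "homeomorphic_map ?G (top_of_set J) ?f"
    using homeomorphic_map_maps by blast
  then have hom: "?G homeomorphic_space top_of_set J"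
    using homeomorphic_map_imp_homeomorphic_space by blast
  have inj: "inj_on ?f (topspace ?G)" and onto: "?f ` topspace ?G = J"
    using homeomorphic_imp_injective_map[OF f] homeomorphic_imp_surjective_map[OF f] by auto
  have top: "topspace ?G = ?q ` X"
    using quotient_imp_surjective_map[OF quotient_map_reeb_quotient[of ?X c]] by simp
  have S: "?S \<subseteq> topspace ?G"
    using top assms(8) by blast
  have fS: "?f ` ?S = c ` C"
    unfolding image_image using assms(8) by (intro image_cong) (auto simp: reeb_induced_quotient)
  let ?E = "topspace ?G - ?S"
  have fE: "?f ` ?E = {a<..<b}"
    using inj_on_image_set_diff[OF inj _ S, of "topspace ?G"] onto fS assms(9) by simp
  have E: "openin ?G ?E"
    using homeomorphic_map_openness[OF f, of ?E] fE assms(9)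
    by (auto simp: openin_open intro!: exI[of _ "{a<..<b}"])
  have "homeomorphic_map (subtopology ?G ?E) (subtopology (top_of_set J) (?f ` ?E)) ?f"
    using onto by (intro homeomorphic_map_subtopologies[OF f]) auto
  then have "subtopology ?G ?E homeomorphic_space top_of_set {a<..<b}"
    using homeomorphic_map_imp_homeomorphic_space fE assms(9)
    by (metis Diff_subset inf.absorb_iff2 subtopology_subtopology)
  moreover have "top_of_set {a<..<b} homeomorphic_space euclideanreal"
  proof -
    obtain f g where "homeomorphism {a<..<b} (UNIV :: real set) f g"
      using homeomorphic_open_interval_UNIV[OF assms(10)] homeomorphic_def by blast
    then have "homeomorphic_maps (top_of_set {a<..<b}) euclideanreal f g"
      by (auto simp: homeomorphism_def homeomorphic_maps_def continuous_map_in_subtopology)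
    then show ?thesis
      using homeomorphic_space_def by blast
  qed
  ultimately have ER: "subtopology ?G ?E homeomorphic_space euclideanreal"
    using homeomorphic_space_trans by blast
  then have "connected_space (subtopology ?G ?E)"
    using homeomorphic_connected_space[OF ER] connectedin_topspace[of euclideanreal] by simp
  moreover have "?E \<noteq> {}"
    using fE assms(10) by force
  ultimately have cells: "one_cells ?G ?S = {?E}"
    unfolding one_cells_def by (auto simp: connected_components_of_eq_singleton simp flip: null_topspace_iff_trivial)
  have "connected_space ?G" "Hausdorff_space ?G"
    using assms(7) homeomorphic_connected_space[OF hom] homeomorphic_Hausdorff_space[OF hom]
    by (simp_all add: is_interval_connected_1 Hausdorff_space_subtopology)
  moreover have "continuous_map ?G euclideanreal ?f"
    using homeomorphic_imp_continuous_map[OF f] by (simp add: continuous_map_in_subtopology)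
  moreover have "closedin ?G ?S"
    using S E by (simp add: closedin_def)
  \<comment> \<open>The cell and the vertices already make up the entire space.\<close>
  moreover have "?G closure_of ?E \<subseteq> ?E \<union> ?S"
    using closure_of_subset_topspace[of ?G ?E] by blast
  moreover have "inj_on ?f ?E"
    using inj inj_on_subset by blast
  ultimately show ?thesis
    unfolding pre_digraph.simps cells using E ER by blast
qed

section \<open>The sphere and the graph over the punctured sphere\<close>

definition equator :: "(real \<times> real \<times> 'a::euclidean_space) set" where
  "equator = {(t, s, y). s = 0 \<and> t * t + y \<bullet> y = 1}"

definition sphere_graph :: "(real \<times> real \<times> 'a::euclidean_space) set" where
  "sphere_graph = {(t, s, y). s * (1 - t) = 1 \<and> t * t + y \<bullet> y = 1}"

definition flatten :: "real \<times> real \<times> 'a::euclidean_space \<Rightarrow> real \<times> real \<times> 'a" where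
  "flatten w = (fst w, 0, snd (snd w))"

text \<open>On the graph, \<open>s y = y / (1 - t)\<close> is the stereographic projection from the pole \<open>t = 1\<close>, and the
  first two components below are equations of the graph where \<open>s \<noteq> 0\<close>.\<close>

definition stereo :: "real \<times> real \<times> 'a::euclidean_space \<Rightarrow> real \<times> real \<times> 'a" where
  "stereo w = (fst (snd w) * (1 - fst w) - 1,
     2 * fst (snd w) - 1 - (fst (snd w) * fst (snd w)) * (snd (snd w) \<bullet> snd (snd w)),
     fst (snd w) *\<^sub>R snd (snd w))"

text \<open>Solves \<open>stereo (t, s, y) = (a, b, c)\<close>: since \<open>c = s y\<close>, the
  number \<open>d = b + 1 + c \<bullet> c\<close> equals \<open>2 * s\<close>, and then
  \<open>t = 1 - (a + 1) / s\<close> and \<open>y = c / s\<close>.\<close>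

definition unstereo :: "real \<times> real \<times> 'a::euclidean_space \<Rightarrow> real \<times> real \<times> 'a" where
  "unstereo w = (let d = fst (snd w) + 1 + snd (snd w) \<bullet> snd (snd w) in
     (1 - 2 * (fst w + 1) / d, d / 2, (2 / d) *\<^sub>R snd (snd w)))"

text \<open>Where \<open>s * (1 - t) = 1\<close>, one has \<open>s * t = s - 1\<close>, and so the
  sphere equation multiplied by \<open>s * s\<close> becomes the second component of
  \<open>stereo\<close>. In that form it is linear in \<open>s\<close> once \<open>s y\<close> is
  known, which makes \<open>stereo\<close> rationally invertible.\<close>

lemma stereo_sphere_graph:
  assumes "s \<noteq> 0"
  shows "stereo (t, s, y) \<in> range (\<lambda>u. (0, 0, u)) \<longleftrightarrow> (t, s, y) \<in> sphere_graph"
proof -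
  have "2 * s - 1 - (s * s) * (y \<bullet> y) = 0 \<longleftrightarrow> t * t + y \<bullet> y = 1" if "s * (1 - t) = 1"
  proof -
    have "s * t = s - 1" using that by (simp add: algebra_simps)
    then have "(s * t) * (s * t) = (s - 1) * (s - 1)" by simp
    then have "2 * s - 1 - (s * s) * (y \<bullet> y) = (s * s) * (1 - (t * t + y \<bullet> y))"
      by (simp add: algebra_simps)
    then show ?thesis using assms by auto
  qed
  then show ?thesis
    by (auto simp: stereo_def sphere_graph_def image_iff)
qed

lemma homeomorphism_stereo:
  "homeomorphism {w. fst (snd w) \<noteq> 0} {w. fst (snd w) + 1 + snd (snd w) \<bullet> snd (snd w) \<noteq> 0}
     stereo unstereo"
proof (rule homeomorphismI)
  show "continuous_on {w. fst (snd w) \<noteq> 0} stereo"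
    unfolding stereo_def by (intro continuous_intros)
  show "continuous_on {w. fst (snd w) + 1 + snd (snd w) \<bullet> snd (snd w) \<noteq> 0} unstereo"
    unfolding unstereo_def Let_def by (intro continuous_intros) auto
  show "unstereo (stereo w) = w" if "w \<in> {w. fst (snd w) \<noteq> 0}" for w
    using that by (cases w) (auto simp: stereo_def unstereo_def field_simps)
  show "stereo (unstereo w) = w"
    if "w \<in> {w. fst (snd w) + 1 + snd (snd w) \<bullet> snd (snd w) \<noteq> 0}" for w
  proof -
    obtain a b c where w: "w = (a, b, c)" by (cases w) auto
    define d where "d = b + 1 + c \<bullet> c"
    have "d \<noteq> 0" using that by (simp add: w d_def)
    have "unstereo w = (1 - 2 * (a + 1) / d, d / 2, (2 / d) *\<^sub>R c)"
      by (simp add: unstereo_def Let_def w d_def)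
    also have "stereo \<dots> = (a, d - 1 - c \<bullet> c, c)"
      using \<open>d \<noteq> 0\<close> by (simp add: stereo_def diff_divide_distrib add_divide_distrib distrib_left)
    finally show ?thesis by (simp add: w d_def)
  qed
qed (auto simp: stereo_def unstereo_def Let_def)

lemma smooth_on_stereo: "open U \<Longrightarrow> smooth_on U stereo"
  unfolding stereo_def by (intro smooth_intros)

lemma smooth_on_unstereo:
  assumes "open V" "\<And>w. w \<in> V \<Longrightarrow> fst (snd w) + 1 + snd (snd w) \<bullet> snd (snd w) \<noteq> 0"
  shows "smooth_on V unstereo"
  unfolding unstereo_def Let_def by (intro smooth_intros) (use assms in auto)

lemma open_stereo_domains:
  "open {w :: real \<times> real \<times> 'a::euclidean_space. fst (snd w) \<noteq> 0}"
  "open {w :: real \<times> real \<times> 'a. fst (snd w) + 1 + snd (snd w) \<bullet> snd (snd w) \<noteq> 0}"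
  by (intro open_Collect_neq continuous_intros)+

lemma subspace_dim_third_axis:
  "subspace (range (\<lambda>u :: 'a::euclidean_space. (0 :: real, 0 :: real, u)))"
  "dim (range (\<lambda>u :: 'a. (0 :: real, 0 :: real, u))) = DIM('a)"
proof -
  have "linear (\<lambda>u :: 'a. (0 :: real, 0 :: real, u))" by (intro linearI) auto
  then show "subspace (range (\<lambda>u :: 'a. (0 :: real, 0 :: real, u)))"
    "dim (range (\<lambda>u :: 'a. (0 :: real, 0 :: real, u))) = DIM('a)"
    by (auto intro!: linear_subspace_image simp: dim_image_eq inj_on_def)
qed

text \<open>As \<open>s\<close> vanishes nowhere on the graph, the single ambient chart
  \<open>stereo\<close> straightens all of it.\<close>

lemma smooth_submanifold_sphere_graph:
  "smooth_submanifold DIM('a) (sphere_graph :: (real \<times> real \<times> 'a::euclidean_space) set)"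
  unfolding smooth_submanifold_def
proof
  let ?M = "sphere_graph :: (real \<times> real \<times> 'a) set"
  let ?U = "{w :: real \<times> real \<times> 'a. fst (snd w) \<noteq> 0}"
  let ?V = "{w :: real \<times> real \<times> 'a. fst (snd w) + 1 + snd (snd w) \<bullet> snd (snd w) \<noteq> 0}"
  let ?L = "range (\<lambda>u :: 'a. (0 :: real, 0 :: real, u))"
  fix p assume p: "p \<in> ?M"
  have "stereo w \<in> ?L \<longleftrightarrow> w \<in> ?M" if "w \<in> ?U" for w
    using that stereo_sphere_graph[of "fst (snd w)" "fst w" "snd (snd w)"] by simp
  then have "stereo ` (?U \<inter> ?M) = stereo ` ?U \<inter> ?L"
    by blast
  then have "stereo ` (?U \<inter> ?M) = ?V \<inter> ?L"
    using homeomorphism_image1[OF homeomorphism_stereo[where 'a = 'a]] by simp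
  moreover have "p \<in> ?U" using p by (auto simp: sphere_graph_def)
  ultimately show "\<exists>U V \<phi> \<psi> L. open U \<and> p \<in> U \<and> open (V :: (real \<times> real \<times> 'a) set) \<and>
        homeomorphism U V \<phi> \<psi> \<and> smooth_on U \<phi> \<and> smooth_on V \<psi> \<and>
        subspace L \<and> dim L = DIM('a) \<and> \<phi> ` (U \<inter> ?M) = V \<inter> L"
    using open_stereo_domains homeomorphism_stereo smooth_on_stereo smooth_on_unstereo[of ?V]
      subspace_dim_third_axis by blast
qed

text \<open>The radius \<open>sqrt 2\<close> is such that, for a unit vector \<open>N\<close>, the unit sphere without \<open>N\<close> is sent
  to the linear hyperplane orthogonal to \<open>N\<close>. This avoids square roots in the charts.\<close>

definition inversion :: "'a::euclidean_space \<Rightarrow> 'a \<Rightarrow> 'a" where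
  "inversion N w = N + (2 / ((w - N) \<bullet> (w - N))) *\<^sub>R (w - N)"

lemma inversion_inversion:
  assumes "w \<noteq> N"
  shows "inversion N (inversion N w) = w"
  using assms by (simp add: inversion_def)

lemma homeomorphism_inversion: "homeomorphism (- {N}) (- {N}) (inversion N) (inversion N)"
proof (rule homeomorphismI)
  show "continuous_on (- {N}) (inversion N)" "continuous_on (- {N}) (inversion N)"
    unfolding inversion_def by (intro continuous_intros; simp)+
qed (auto simp: inversion_inversion, auto simp: inversion_def)

lemma smooth_on_inversion: "smooth_on (- {N}) (inversion N)"
  unfolding inversion_def by (intro smooth_intros) auto

text \<open>With \<open>d = |w - N|^2\<close>, the first coordinate of the image vanishes iff
  \<open>|w| = 1\<close>, and the second iff \<open>s = 0\<close>. Both poles \<open>n = 1\<close>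
  and \<open>n = -1\<close> are treated at once.\<close>

lemma inversion_equator:
  fixes w :: "real \<times> real \<times> 'a::euclidean_space"
  assumes "n * n = 1" "w \<noteq> (n, 0, 0)"
  shows "inversion (n, 0, 0) w \<in> range (\<lambda>u. (0, 0, u)) \<longleftrightarrow> w \<in> equator"
proof -
  obtain t s y where w: "w = (t, s, y)" by (cases w) auto
  define d where "d = (w - (n, 0, 0)) \<bullet> (w - (n, 0, 0))"
  have "d \<noteq> 0" using assms(2) by (simp add: d_def)
  have d: "d = t * t + s * s + y \<bullet> y + 1 - 2 * (n * t)"
    using assms(1) by (simp add: d_def w algebra_simps)
  have "n + 2 / d * (t - n) = 0 \<longleftrightarrow> d * n + 2 * (t - n) = 0"
    using \<open>d \<noteq> 0\<close> by (simp add: field_simps)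
  \<comment> \<open>Multiplying by the unit \<open>n\<close> makes every \<open>n * n\<close>
    collapse to \<open>1\<close>; what is left is \<open>|w|^2 - 1\<close>.\<close>
  also have "\<dots> \<longleftrightarrow> n * (d * n + 2 * (t - n)) = 0"
    using assms(1) by auto
  also have "n * (d * n + 2 * (t - n)) = d * (n * n) + 2 * (n * t) - 2 * (n * n)"
    by (simp add: algebra_simps)
  finally have "n + 2 / d * (t - n) = 0 \<longleftrightarrow> t * t + s * s + y \<bullet> y = 1"
    using assms(1) d by auto
  moreover have "inversion (n, 0, 0) w = (n + 2 / d * (t - n), 2 / d * s, (2 / d) *\<^sub>R y)"
    by (simp add: inversion_def d_def[symmetric]) (simp add: w)
  ultimately show ?thesis
    using \<open>d \<noteq> 0\<close> by (auto simp: equator_def w image_iff)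
qed

lemma smooth_submanifold_equator:
  "smooth_submanifold DIM('a) (equator :: (real \<times> real \<times> 'a::euclidean_space) set)"
  unfolding smooth_submanifold_def
proof
  let ?M = "equator :: (real \<times> real \<times> 'a) set"
  let ?L = "range (\<lambda>u :: 'a. (0 :: real, 0 :: real, u))"
  fix p assume p: "p \<in> ?M"
  \<comment> \<open>Two distinct poles are available, so one of them differs from \<open>p\<close>;
    the inversion centred there is the chart.\<close>
  obtain n :: real where n: "n * n = 1" "p \<noteq> (n, 0, 0)"
    by (metis mult_1 mult_minus1 minus_minus one_neq_neg_one prod.inject)
  let ?N = "(n, 0, 0) :: real \<times> real \<times> 'a"
  let ?I = "inversion ?N"
  have "?I ` (- {?N} \<inter> ?M) = ?I ` (- {?N}) \<inter> ?L"
    using inversion_equator[OF n(1)] by blast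
  then have "?I ` (- {?N} \<inter> ?M) = - {?N} \<inter> ?L"
    using homeomorphism_image1[OF homeomorphism_inversion] by metis
  then show "\<exists>U V \<phi> \<psi> L. open U \<and> p \<in> U \<and> open (V :: (real \<times> real \<times> 'a) set) \<and>
        homeomorphism U V \<phi> \<psi> \<and> smooth_on U \<phi> \<and> smooth_on V \<psi> \<and>
        subspace L \<and> dim L = DIM('a) \<and> \<phi> ` (U \<inter> ?M) = V \<inter> L"
    using n(2) homeomorphism_inversion smooth_on_inversion subspace_dim_third_axis
    by (intro exI[of _ "- {?N}"] exI[of _ ?I] exI[of _ ?L]) auto
qed

text \<open>Stereographic projection is the polynomial map \<open>s y\<close>, and its inverse has
  the denominator \<open>1 + u \<bullet> u\<close>, which never vanishes. Both maps are thus smooth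
  on entire Euclidean spaces and serve as their own extensions.\<close>

lemma diffeomorphic_sphere_graph:
  "diffeomorphic (sphere_graph :: (real \<times> real \<times> 'a::euclidean_space) set) (UNIV :: 'a set)"
proof -
  let ?M = "sphere_graph :: (real \<times> real \<times> 'a) set"
  let ?f = "\<lambda>w :: real \<times> real \<times> 'a. snd (snd (stereo w))"
  let ?g = "\<lambda>u :: 'a. unstereo (0, 0, u)"
  have pos: "1 + u \<bullet> u \<noteq> 0" for u :: 'a
    using inner_ge_zero[of u] by linarith
  have g: "stereo (?g u) = (0, 0, u)" "fst (snd (?g u)) \<noteq> 0" for u
    using homeomorphism_apply2[OF homeomorphism_stereo, of "(0, 0, u)"] pos
    by (auto simp: unstereo_def Let_def)
  have fM: "stereo w = (0, 0, ?f w)" "fst (snd w) \<noteq> 0" if "w \<in> ?M" for w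
  proof -
    obtain t s y where w: "w = (t, s, y)" by (cases w) auto
    then have "s \<noteq> 0" using that by (auto simp: sphere_graph_def)
    then show "stereo w = (0, 0, ?f w)" "fst (snd w) \<noteq> 0"
      using stereo_sphere_graph[of s t y] that by (auto simp: w)
  qed
  have f: "smooth_on UNIV ?f"
    unfolding stereo_def by (simp, intro smooth_intros) auto
  have gs: "smooth_on UNIV ?g"
    unfolding unstereo_def Let_def by (simp, intro smooth_intros) (auto simp: pos)
  have "continuous_on UNIV ?f" "continuous_on UNIV ?g"
    using f gs unfolding smooth_on_def by (metis Ck_on.simps(1))+
  moreover have "?g u \<in> ?M" for u
    using g stereo_sphere_graph by (metis prod.collapse rangeI)
  moreover have "?g (?f w) = w" if "w \<in> ?M" for w
    using fM[OF that] homeomorphism_apply1[OF homeomorphism_stereo, of w] by auto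
  ultimately have "homeomorphism ?M UNIV ?f ?g"
    using g by (intro homeomorphismI) (auto intro: continuous_on_subset)
  then show ?thesis
    unfolding diffeomorphic_def
    using smooth_map_onI[OF f open_UNIV subset_UNIV refl]
      smooth_map_onI[OF gs open_UNIV subset_UNIV refl] by blast
qed

section \<open>Topology and diffeomorphism type of the sphere\<close>

lemma equator_eq_image_sphere:
  "equator = (\<lambda>w. (fst w, 0, snd w)) ` sphere (0 :: real \<times> 'a::euclidean_space) 1"
proof -
  have "(t, y) \<in> sphere 0 1 \<longleftrightarrow> t * t + y \<bullet> y = 1" for t and y :: 'a
    by (simp add: norm_eq_1)
  then show ?thesis
    by (force simp: equator_def image_iff)
qed

lemma compact_equator: "compact (equator :: (real \<times> real \<times> 'a::euclidean_space) set)"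
  unfolding equator_eq_image_sphere by (intro compact_continuous_image continuous_intros) auto

lemma connected_equator: "connected (equator :: (real \<times> real \<times> 'a::euclidean_space) set)"
  unfolding equator_eq_image_sphere
  by (intro connected_continuous_image continuous_intros connected_sphere) (simp add: DIM_positive Suc_leI)

lemma diffeomorphic_equator:
  "diffeomorphic (equator :: (real \<times> real \<times> 'a::euclidean_space) set) (sphere (0 :: real \<times> 'a) 1)"
proof -
  let ?f = "\<lambda>w :: real \<times> real \<times> 'a. (fst w, snd (snd w))"
  let ?g = "\<lambda>w :: real \<times> 'a. (fst w, 0 :: real, snd w)"
  have "homeomorphism equator (sphere 0 1) ?f ?g"
    unfolding equator_eq_image_sphere
    by (intro homeomorphismI continuous_intros) auto
  moreover have fg: "smooth_on UNIV ?f" "smooth_on UNIV ?g"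
    by (intro smooth_intros; simp)+
  ultimately show ?thesis
    unfolding diffeomorphic_def
    using smooth_map_onI[OF fg(1) open_UNIV subset_UNIV refl]
      smooth_map_onI[OF fg(2) open_UNIV subset_UNIV refl] by blast
qed

section \<open>The graph as a regular zero set\<close>

lemma has_derivative_sphere_graph_equations:
  "((\<lambda>w. (fst w * fst w + snd (snd w) \<bullet> snd (snd w) - 1, fst (snd w) * (1 - fst w) - 1)) has_derivative
    (\<lambda>h. (2 * (fst p * fst h + snd (snd p) \<bullet> snd (snd h)),
          fst (snd h) * (1 - fst p) - fst (snd p) * fst h))) (at p)"
  by (auto intro!: derivative_eq_intros simp: inner_commute algebra_simps)

lemma real_analytic_manifold_sphere_graph:
  "real_analytic_manifold TYPE(real \<times> real) DIM('a)
     (sphere_graph :: (real \<times> real \<times> 'a::euclidean_space) set)"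
proof -
  let ?M = "sphere_graph :: (real \<times> real \<times> 'a) set"
  define e :: "real \<times> real \<times> 'a \<Rightarrow> real \<times> real" where
    "e = (\<lambda>w. (fst w * fst w + snd (snd w) \<bullet> snd (snd w) - 1, fst (snd w) * (1 - fst w) - 1))"
  define L :: "real \<times> real \<times> 'a \<Rightarrow> real \<times> real" where
    "L = (\<lambda>w. (0, fst (snd w)))"
  define B :: "real \<times> real \<times> 'a \<Rightarrow> real \<times> real \<times> 'a \<Rightarrow> real \<times> real" where
    "B = (\<lambda>v w. (fst v * fst w + snd (snd v) \<bullet> snd (snd w), - (fst (snd v) * fst w)))"
  have "linear L"
    unfolding L_def by (intro linearI) auto
  moreover have "bilinear B"
    unfolding B_def bilinear_def by (auto intro!: linearI simp: algebra_simps inner_simps)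
  ultimately have "real_analytic_on UNIV (\<lambda>w. (- 1, - 1) + L w + B w w)"
    by (rule real_analytic_on_quadratic)
  also have "(\<lambda>w. (- 1, - 1) + L w + B w w) = e"
    by (auto simp: e_def L_def B_def algebra_simps)
  finally have an: "real_analytic_on UNIV e" .
  have M: "?M = {x. e x = 0}"
    by (auto simp: sphere_graph_def e_def zero_prod_def)
  obtain f g where "homeomorphism ?M (UNIV :: 'a set) f g"
    using diffeomorphic_sphere_graph unfolding diffeomorphic_def by blast
  then have "?M = g ` UNIV" "continuous_on UNIV g"
    by (auto simp: homeomorphism_def)
  \<comment> \<open>The zero set is a continuous image of a Euclidean space, hence its own only
    component.\<close>
  then have "connected ?M" "?M \<noteq> {}"
    by (metis connected_continuous_image connected_UNIV, auto)
  then have "components {x. e x = 0} = {?M}"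
    using M components_eq_sing_iff by metis
  then have comp: "\<exists>\<C>. \<C> \<subseteq> components {x. e x = 0} \<and> ?M = \<Union>\<C>"
    by auto
  have "dim (range (frechet_derivative e (at p))) = DIM(real \<times> real)" if "p \<in> ?M" for p
  proof -
    obtain t s y where p: "p = (t, s, y)" by (cases p) auto
    then have eq: "s * (1 - t) = 1" "t * t + y \<bullet> y = 1"
      using that by (auto simp: sphere_graph_def)
    then have "1 - t \<noteq> 0" by auto
    let ?D = "\<lambda>h. (2 * (fst p * fst h + snd (snd p) \<bullet> snd (snd h)),
          fst (snd h) * (1 - fst p) - fst (snd p) * fst h)"
    have D: "frechet_derivative e (at p) = ?D"
      unfolding e_def by (rule frechet_derivative_at[symmetric, OF has_derivative_sphere_graph_equations])
    have "(\<alpha>, \<beta>) \<in> range ?D" for \<alpha> \<beta>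
    proof (rule range_eqI)
      \<comment> \<open>The vector \<open>\<alpha> / 2\<close> times \<open>(t, y)\<close> is radial
        and gives the sphere equation the derivative \<open>\<alpha>\<close>, as
        \<open>t * t + y \<bullet> y = 1\<close>. The component along \<open>s\<close> affects the
        other equation only and is solved for \<open>\<beta>\<close>, since \<open>1 - t\<close> is
        nonzero.\<close>
      let ?h = "\<alpha> * t / 2"
      have "2 * (t * ?h + y \<bullet> ((\<alpha> / 2) *\<^sub>R y)) = \<alpha> * (t * t + y \<bullet> y)"
        by (simp add: algebra_simps)
      moreover have "(\<beta> + s * ?h) / (1 - t) * (1 - t) - s * ?h = \<beta>"
        using \<open>1 - t \<noteq> 0\<close> by simp
      ultimately show "(\<alpha>, \<beta>) = ?D (?h, (\<beta> + s * ?h) / (1 - t), (\<alpha> / 2) *\<^sub>R y)"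
        unfolding p fst_conv snd_conv eq by simp
    qed
    then have "range ?D = UNIV" by auto
    then show ?thesis unfolding D by (metis dim_UNIV)
  qed
  then show ?thesis
    unfolding real_analytic_manifold_def using an comp by (intro conjI exI[of _ e]) auto
qed

section \<open>Critical points\<close>

lemma smooth_map_on_fst: "smooth_map_on M fst"
  using smooth_map_onI[OF smooth_on_linear[OF bounded_linear_fst]] by blast

lemma critical_points_fst:
  "critical_points M fst = {p \<in> M. fst ` tangent_space M p \<noteq> UNIV}"
proof -
  have "differential M fst p ` tangent_space M p = fst ` tangent_space M p" if "p \<in> M" for p
    using that differential_tangent[OF smooth_map_on_fst that
        bounded_linear_imp_has_derivative[OF bounded_linear_fst]]
    by (intro image_cong) auto
  then show ?thesis
    unfolding critical_points_def by blast
qed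

text \<open>Along any curve in \<open>M\<close> through \<open>p\<close> the first coordinate has an
  extremum at \<open>0\<close>, so every tangent vector has first component
  \<open>0\<close>.\<close>

lemma extremum_critical_fst:
  assumes "p \<in> M" "(\<forall>x\<in>M. fst x \<le> fst p) \<or> (\<forall>x\<in>M. fst p \<le> fst x)"
  shows "p \<in> critical_points M fst"
proof -
  have "fst v = 0" if v: "v \<in> tangent_space M p" for v
  proof -
    obtain \<gamma> \<epsilon> where \<gamma>: "0 < \<epsilon>" "\<gamma> ` {-\<epsilon><..<\<epsilon>} \<subseteq> M" "\<gamma> 0 = p"
        "(\<gamma> has_vector_derivative v) (at (0::real))"
      using v unfolding tangent_space_def by blast
    have d: "((\<lambda>\<tau>. fst (\<gamma> \<tau>)) has_real_derivative fst v) (at 0)"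
      using bounded_linear.has_vector_derivative[OF bounded_linear_fst \<gamma>(4)]
      by (simp add: has_real_derivative_iff_has_vector_derivative)
    have "\<gamma> \<tau> \<in> M" if "\<bar>0 - \<tau>\<bar> < \<epsilon>" for \<tau>
      using that \<gamma>(2) by (auto simp: image_subset_iff abs_less_iff)
    then show ?thesis
      using assms(2) \<gamma>(3) DERIV_local_max[OF d \<gamma>(1)] DERIV_local_min[OF d \<gamma>(1)] by metis
  qed
  then have "1 \<notin> fst ` tangent_space M p"
    by force
  then show ?thesis
    using assms(1) by (auto simp: critical_points_fst)
qed

text \<open>\<open>differential\<close> sees only the restriction of \<open>f\<close> to
  \<open>M\<close>, so \<open>f\<close> may be exchanged for the zero map. This supplies linear
  equations for tangent vectors from the equations of \<open>M\<close>.\<close>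

lemma tangent_space_kernel:
  assumes "smooth_map_on M f" "p \<in> M" "(f has_derivative f') (at p)" "v \<in> tangent_space M p"
    and "\<And>x. x \<in> M \<Longrightarrow> f x = 0"
  shows "f' v = 0"
proof -
  have "smooth_local_extension M f p = smooth_local_extension M (\<lambda>_. 0) p"
    using assms(5) by (auto simp: smooth_local_extension_def fun_eq_iff)
  then have "differential M f p = differential M (\<lambda>_. 0) p"
    by (simp add: differential_def)
  moreover have "smooth_map_on M (\<lambda>_. 0 :: 'b)"
    by (rule smooth_map_onI[of UNIV]) (auto intro!: smooth_intros)
  ultimately show ?thesis
    using differential_tangent[OF assms(1-4)]
      differential_tangent[OF _ assms(2) has_derivative_const assms(4)] by metis
qed

lemma linear_image_tangent_space:
  assumes "bounded_linear L" "L ` M \<subseteq> N"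
  shows "L ` tangent_space M p \<subseteq> tangent_space N (L p)"
proof
  fix w assume "w \<in> L ` tangent_space M p"
  then obtain v \<gamma> \<epsilon> where \<gamma>: "w = L v" "0 < \<epsilon>" "smooth_on {-\<epsilon><..<\<epsilon>} \<gamma>" "\<gamma> ` {-\<epsilon><..<\<epsilon>} \<subseteq> M"
      "\<gamma> 0 = p" "(\<gamma> has_vector_derivative v) (at (0::real))"
    unfolding tangent_space_def by blast
  have "smooth_on {-\<epsilon><..<\<epsilon>} (\<lambda>\<tau>. L (\<gamma> \<tau>))" "((\<lambda>\<tau>. L (\<gamma> \<tau>)) has_vector_derivative w) (at 0)"
    using \<gamma> bounded_linear.has_vector_derivative[OF assms(1)]
      smooth_on_linear_compose[OF assms(1) open_greaterThanLessThan] by blast+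
  moreover have "(\<lambda>\<tau>. L (\<gamma> \<tau>)) ` {-\<epsilon><..<\<epsilon>} \<subseteq> N"
    using \<gamma>(4) assms(2) by blast
  ultimately show "w \<in> tangent_space N (L p)"
    unfolding tangent_space_def using \<gamma>(2,5) by blast
qed

text \<open>The curve runs along the meridian through \<open>p\<close>, radially in stereographic coordinates.\<close>

lemma fst_tangent_space_sphere_graph:
  fixes p :: "real \<times> real \<times> 'a::euclidean_space"
  assumes "p \<in> sphere_graph" "snd (snd p) \<noteq> 0"
  shows "fst ` tangent_space sphere_graph p = UNIV"
proof -
  have "r \<in> fst ` tangent_space sphere_graph p" for r
  proof -
    define u where "u = snd (snd (stereo p))"
    have s: "fst (snd p) \<noteq> 0" using assms(1) by (auto simp: sphere_graph_def)
    then have st: "stereo p = (0, 0, u)"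
      using assms(1) stereo_sphere_graph[of "fst (snd p)" "fst p" "snd (snd p)"]
      by (auto simp: u_def)
    have "u \<noteq> 0" using s assms(2) by (simp add: u_def stereo_def)
    define q where "q = u \<bullet> u"
    have "q > 0" using \<open>u \<noteq> 0\<close> by (simp add: q_def)
    \<comment> \<open>With \<open>q = |u|^2\<close>, the first coordinate of the curve is
      \<open>1 - 2 / (1 + (1 + k * \<tau>)^2 * q)\<close>, with derivative
      \<open>4 * k * q / (q + 1)^2\<close> at \<open>0\<close>; \<open>k\<close> makes this equal to
      \<open>r\<close>.\<close>
    define k where "k = r * (q + 1) * (q + 1) / (4 * q)"
    define v where "v = (\<lambda>\<tau> :: real. (1 + k * \<tau>) *\<^sub>R u)"
    define \<gamma> where "\<gamma> = (\<lambda>\<tau>. unstereo (0, 0, v \<tau>))"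
    have pos: "1 + v \<tau> \<bullet> v \<tau> \<noteq> 0" for \<tau>
      using inner_ge_zero[of "v \<tau>"] by linarith
    have "smooth_on {-1<..<1} \<gamma>"
      unfolding \<gamma>_def unstereo_def Let_def
      by (simp, intro smooth_intros) (use pos in \<open>auto simp: v_def intro!: smooth_intros\<close>)
    moreover have "\<gamma> \<tau> \<in> sphere_graph" for \<tau>
    proof -
      have "stereo (\<gamma> \<tau>) = (0, 0, v \<tau>)"
        using homeomorphism_apply2[OF homeomorphism_stereo, of "(0, 0, v \<tau>)"] pos by (simp add: \<gamma>_def)
      moreover have "fst (snd (\<gamma> \<tau>)) \<noteq> 0"
        using pos by (simp add: \<gamma>_def unstereo_def Let_def)
      ultimately show ?thesis
        using stereo_sphere_graph by (metis prod.collapse rangeI)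
    qed
    moreover have "\<gamma> 0 = p"
      using homeomorphism_apply1[OF homeomorphism_stereo, of p] s st by (simp add: \<gamma>_def v_def)
    \<comment> \<open>Only the first component of the velocity matters; it is identified with
      \<open>r\<close> by uniqueness of derivatives.\<close>
    moreover define w where "w = vector_derivative \<gamma> (at 0)"
    moreover have w: "(\<gamma> has_vector_derivative w) (at 0)"
      using smooth_on_imp_differentiable[OF \<open>smooth_on {-1<..<1} \<gamma>\<close>, of 0]
      by (simp add: w_def vector_derivative_works)
    ultimately have "w \<in> tangent_space sphere_graph p"
      unfolding tangent_space_def by (intro CollectI exI[of _ \<gamma>] exI[of _ 1]) auto
    moreover have "((\<lambda>\<tau>. fst (\<gamma> \<tau>)) has_real_derivative fst w) (at 0)"
      using bounded_linear.has_vector_derivative[OF bounded_linear_fst w]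
      by (simp add: has_real_derivative_iff_has_vector_derivative)
    moreover have "((\<lambda>\<tau>. fst (\<gamma> \<tau>)) has_real_derivative r) (at 0)"
    proof -
      have "(\<lambda>\<tau>. fst (\<gamma> \<tau>)) = (\<lambda>\<tau>. 1 - 2 / (1 + (1 + k * \<tau>) * (1 + k * \<tau>) * q))"
        by (simp add: \<gamma>_def unstereo_def Let_def v_def q_def mult.assoc)
      moreover have D: "((\<lambda>\<tau>. 1 + (1 + k * \<tau>) * (1 + k * \<tau>) * q) has_real_derivative 2 * k * q) (at 0)"
        by (auto intro!: derivative_eq_intros)
      have "((\<lambda>\<tau>. 1 - 2 / (1 + (1 + k * \<tau>) * (1 + k * \<tau>) * q)) has_real_derivative
          2 * (2 * k * q) / ((q + 1) * (q + 1))) (at 0)"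
        using \<open>q > 0\<close> by (auto intro!: derivative_eq_intros D simp: add.commute)
      moreover have "2 * (2 * k * q) / ((q + 1) * (q + 1)) = r"
        using \<open>q > 0\<close> by (simp add: k_def)
      ultimately show ?thesis by simp
    qed
    ultimately show ?thesis
      using DERIV_unique by (metis image_eqI)
  qed
  then show ?thesis by blast
qed

lemma bounded_linear_flatten: "bounded_linear flatten"
  unfolding flatten_def
  by (intro bounded_linear_Pair bounded_linear_fst bounded_linear_zero
      bounded_linear_compose[OF bounded_linear_snd bounded_linear_snd])

lemma flatten_sphere_graph:
  "flatten ` sphere_graph = equator - {(1, 0, 0 :: 'a::euclidean_space)}"
proof (intro subset_antisym subsetI)
  fix w :: "real \<times> real \<times> 'a"
  assume "w \<in> equator - {(1, 0, 0)}"
  then obtain t y where w: "w = (t, 0, y)" "t * t + y \<bullet> y = 1" "t = 1 \<longrightarrow> y \<noteq> 0"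
    by (auto simp: equator_def)
  then have "t \<noteq> 1" by auto
  then have "(t, 1 / (1 - t), y) \<in> sphere_graph"
    using w(2) by (simp add: sphere_graph_def)
  then show "w \<in> flatten ` sphere_graph"
    by (rule rev_image_eqI) (simp add: flatten_def w(1))
qed (auto simp: equator_def flatten_def sphere_graph_def)

lemma abs_fst_le_1:
  assumes "t * t + y \<bullet> y = 1"
  shows "\<bar>t :: real\<bar> \<le> 1"
proof -
  have "t * t \<le> 1"
    using assms inner_ge_zero[of y] by linarith
  then show ?thesis
    by (simp add: abs_square_le_1[symmetric] power2_eq_square)
qed

text \<open>Points with nonzero \<open>y\<close> are regular by the meridian curves. On the axis
  \<open>y = 0\<close> the sphere has \<open>t = 1\<close>, absent from the graph, and
  \<open>t = -1\<close>, the minimum, where \<open>s = 1 / 2\<close>.\<close>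

lemma critical_points_sphere_graph:
  "critical_points sphere_graph fst = {(- 1, 1 / 2, 0 :: 'a::euclidean_space)}"
proof
  have "p = (- 1, 1 / 2, 0)" if "p \<in> critical_points sphere_graph fst" for p :: "real \<times> real \<times> 'a"
  proof -
    have "p \<in> sphere_graph" "snd (snd p) = 0"
      using that fst_tangent_space_sphere_graph[of p] unfolding critical_points_fst by blast+
    then show ?thesis
      by (auto simp: sphere_graph_def square_eq_1_iff)
  qed
  then show "critical_points sphere_graph fst \<subseteq> {(- 1, 1 / 2, 0 :: 'a)}"
    by blast
  show "{(- 1, 1 / 2, 0 :: 'a)} \<subseteq> critical_points sphere_graph fst"
    using abs_fst_le_1 by (fastforce intro!: extremum_critical_fst simp: sphere_graph_def)
qed

lemma critical_points_equator:
  "critical_points equator fst = {(- 1, 0, 0), (1, 0, 0 :: 'a::euclidean_space)}"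
proof
  have "p \<in> {(- 1, 0, 0), (1, 0, 0)}" if "p \<in> critical_points equator fst" for p :: "real \<times> real \<times> 'a"
  proof -
    have p: "p \<in> equator" "fst ` tangent_space equator p \<noteq> UNIV"
      using that by (auto simp: critical_points_fst)
    have "snd (snd p) = 0"
    proof (rule ccontr)
      assume "snd (snd p) \<noteq> 0"
      then have "p \<in> flatten ` sphere_graph"
        using p(1) unfolding flatten_sphere_graph by auto
      then obtain p' where p': "p' \<in> sphere_graph" "p = flatten p'" by blast
      \<comment> \<open>\<open>flatten\<close> keeps the first coordinate, so the tangent vectors
        that it carries over from the graph already attain every real first component.\<close>
      then have "UNIV = fst ` flatten ` tangent_space sphere_graph p'"
        using fst_tangent_space_sphere_graph[of p'] \<open>snd (snd p) \<noteq> 0\<close>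
        by (simp add: flatten_def image_image)
      also have "\<dots> \<subseteq> fst ` tangent_space equator p"
        using linear_image_tangent_space[OF bounded_linear_flatten, of sphere_graph equator p']
          flatten_sphere_graph p'(2) by blast
      finally show False using p(2) by blast
    qed
    then show ?thesis
      using p(1) by (auto simp: equator_def square_eq_1_iff)
  qed
  then show "critical_points equator fst \<subseteq> {(- 1, 0, 0), (1, 0, 0 :: 'a)}"
    by blast
  show "{(- 1, 0, 0), (1, 0, 0 :: 'a)} \<subseteq> critical_points equator fst"
    using abs_fst_le_1 by (fastforce intro!: extremum_critical_fst simp: equator_def)
qed

text \<open>As a linear map \<open>flatten\<close> kills the direction \<open>s\<close>. On tangent
  vectors it is injective nonetheless: differentiating \<open>s * (1 - t) = 1\<close> determines the
  \<open>s\<close> component from the \<open>t\<close> component.\<close>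

lemma smooth_embedding_flatten:
  "smooth_embedding (sphere_graph :: (real \<times> real \<times> 'a::euclidean_space) set) equator flatten"
proof -
  let ?M = "sphere_graph :: (real \<times> real \<times> 'a) set"
  have sm: "smooth_map_on ?M flatten"
    using smooth_map_onI[OF smooth_on_linear[OF bounded_linear_flatten]] by blast
  have "inj_on (differential ?M flatten p) (tangent_space ?M p)" if p: "p \<in> ?M" for p
  proof (rule inj_onI)
    let ?e = "\<lambda>w :: real \<times> real \<times> 'a. fst (snd w) * (1 - fst w) - 1"
    have e: "smooth_map_on ?M ?e"
      by (rule smooth_map_onI[of UNIV ?e]) (auto intro!: smooth_intros)
    have e': "(?e has_derivative (\<lambda>h. fst (snd h) * (1 - fst p) - fst (snd p) * fst h)) (at p)"
      by (auto intro!: derivative_eq_intros)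
    have tan: "fst (snd h) * (1 - fst p) = fst (snd p) * fst h" if "h \<in> tangent_space ?M p" for h
      using tangent_space_kernel[OF e p e' that] by (auto simp: sphere_graph_def)
    fix v w assume v: "v \<in> tangent_space ?M p" "w \<in> tangent_space ?M p"
      and "differential ?M flatten p v = differential ?M flatten p w"
    then have "flatten v = flatten w"
      using differential_tangent[OF sm p bounded_linear_imp_has_derivative[OF bounded_linear_flatten]]
      by simp
    moreover have "1 - fst p \<noteq> 0" using p by (auto simp: sphere_graph_def)
    ultimately show "v = w"
      using tan[OF v(1)] tan[OF v(2)] mult_right_cancel[of "1 - fst p" "fst (snd v)" "fst (snd w)"]
      by (simp add: flatten_def prod_eq_iff)
  qed
  moreover have "embedding_map (top_of_set ?M) (top_of_set equator) flatten"
  proof -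
    let ?N = "equator - {(1, 0, 0)} :: (real \<times> real \<times> 'a) set"
    let ?g = "\<lambda>w :: real \<times> real \<times> 'a. (fst w, 1 / (1 - fst w), snd (snd w))"
    have "1 - fst w \<noteq> 0" if "w \<in> ?N" for w
      using that by (auto simp: equator_def)
    then have "continuous_on ?N ?g"
      by (intro continuous_intros) auto
    moreover have gf: "?g (flatten w) = w" if "w \<in> ?M" for w
      using that by (auto simp: flatten_def sphere_graph_def divide_eq_eq split: if_splits)
    moreover have "?g w \<in> ?M" "flatten (?g w) = w" if w: "w \<in> ?N" for w
    proof -
      obtain v where "v \<in> ?M" "w = flatten v"
        using w unfolding flatten_sphere_graph[symmetric] by blast
      then show "?g w \<in> ?M" "flatten (?g w) = w"
        by (simp_all only: gf)
    qed
    ultimately have "homeomorphism ?M ?N flatten ?g"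
      using linear_continuous_on[OF bounded_linear_flatten, of ?M]
        equalityD1[OF flatten_sphere_graph[where 'a = 'a]]
      by (intro homeomorphismI) blast+
    then have "homeomorphic_maps (top_of_set ?M) (top_of_set ?N) flatten ?g"
      by (auto simp: homeomorphism_def homeomorphic_maps_def continuous_map_in_subtopology)
    then have "homeomorphic_map (top_of_set ?M) (top_of_set ?N) flatten"
      using homeomorphic_map_maps by blast
    moreover have "equator \<inter> flatten ` ?M = ?N"
      using flatten_sphere_graph by blast
    ultimately show ?thesis
      unfolding embedding_map_def by (simp add: subtopology_subtopology)
  qed
  ultimately show ?thesis
    using sm by (simp add: smooth_embedding_def)
qed

section \<open>The Reeb digraphs\<close>

text \<open>The fibres are spheres in the last factor, possibly degenerate or empty. Dimension at
  least 2 is what keeps those of positive radius from being pairs of points.\<close>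

lemma connected_fibres:
  assumes "2 \<le> DIM('a)"
  shows "connected {x \<in> sphere_graph :: (real \<times> real \<times> 'a::euclidean_space) set. fst x = t}"
    and "connected {x \<in> equator :: (real \<times> real \<times> 'a) set. fst x = t}"
proof -
  let ?S = "{y :: 'a. t * t + y \<bullet> y = 1}"
  \<comment> \<open>Right for \<open>|t| > 1\<close> too: \<open>sqrt\<close> is odd, so the radius
    is then negative and both sets are empty.\<close>
  have "?S = sphere 0 (sqrt (1 - t * t))"
    by (auto simp: norm_eq_sqrt_inner)
  then have conn: "connected ((\<lambda>y. (t, s, y)) ` ?S)" for s :: real
    using connected_sphere[OF assms, of 0 "sqrt (1 - t * t)"]
    by (intro connected_continuous_image continuous_intros) simp
  have "{x \<in> sphere_graph. fst x = t} = (if t = 1 then {} else (\<lambda>y. (t, 1 / (1 - t), y)) ` ?S)"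
    by (auto simp: sphere_graph_def eq_divide_eq)
  then show "connected {x \<in> sphere_graph :: (real \<times> real \<times> 'a) set. fst x = t}"
    by (simp only: conn connected_empty split: if_split) simp
  have "{x \<in> equator. fst x = t} = (\<lambda>y. (t, 0, y)) ` ?S"
    by (auto simp: equator_def)
  then show "connected {x \<in> equator :: (real \<times> real \<times> 'a) set. fst x = t}"
    by (simp only: conn)
qed

lemma reeb_digraph_defined_sphere_graph:
  assumes "2 \<le> DIM('a)"
  shows "reeb_digraph_defined (sphere_graph :: (real \<times> real \<times> 'a::euclidean_space) set) fst"
proof -
  obtain e :: 'a where "e \<in> Basis" using nonempty_Basis by blast
  then have e: "e \<bullet> e = 1" by (simp add: inner_same_Basis)
  have sq: "t * t \<le> 1" if "t \<in> {-1..<1}" for t :: real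
    using that abs_square_le_1[of t] by (auto simp: power2_eq_square)
  show ?thesis
    unfolding reeb_digraph_defined_def reeb_digraph_def
  \<comment> \<open>The section is the meridian through the unit vector \<open>e\<close>, lifted to
    the graph. The sole critical value \<open>-1\<close> is the sole endpoint belonging to
    \<open>J\<close>, so removing it leaves an open interval.\<close>
  proof (rule pre_digraph_reeb_space[where J = "{-1..<1}" and a = "-1" and b = 1 and
        s = "\<lambda>t. (t, 1 / (1 - t), sqrt (1 - t * t) *\<^sub>R e)", OF connected_fibres(1)[OF assms]])
    show "fst ` (sphere_graph :: (real \<times> real \<times> 'a) set) \<subseteq> {-1..<1}"
      using abs_fst_le_1 by (fastforce simp: sphere_graph_def abs_le_iff order.strict_iff_order)
    show "(\<lambda>t. (t, 1 / (1 - t), sqrt (1 - t * t) *\<^sub>R e)) ` {-1..<1} \<subseteq> sphere_graph"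
      using sq e by (auto simp: sphere_graph_def)
    show "critical_points sphere_graph fst \<subseteq> (sphere_graph :: (real \<times> real \<times> 'a) set)"
      by (auto simp: critical_points_def)
  qed (auto simp: critical_points_sphere_graph intro!: continuous_intros)
qed

lemma reeb_digraph_defined_equator:
  assumes "2 \<le> DIM('a)"
  shows "reeb_digraph_defined (equator :: (real \<times> real \<times> 'a::euclidean_space) set) fst"
proof -
  obtain e :: 'a where "e \<in> Basis" using nonempty_Basis by blast
  then have e: "e \<bullet> e = 1" by (simp add: inner_same_Basis)
  have sq: "t * t \<le> 1" if "t \<in> {-1..1}" for t :: real
    using that abs_square_le_1[of t] by (auto simp: power2_eq_square)
  show ?thesis
    unfolding reeb_digraph_defined_def reeb_digraph_def
  proof (rule pre_digraph_reeb_space[where J = "{-1..1}" and a = "-1" and b = 1 and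
        s = "\<lambda>t. (t, 0, sqrt (1 - t * t) *\<^sub>R e)", OF connected_fibres(2)[OF assms]])
    show "fst ` (equator :: (real \<times> real \<times> 'a) set) \<subseteq> {-1..1}"
      using abs_fst_le_1 by (fastforce simp: equator_def abs_le_iff)
    show "(\<lambda>t. (t, 0, sqrt (1 - t * t) *\<^sub>R e)) ` {-1..1} \<subseteq> equator"
      using sq e by (auto simp: equator_def)
    show "critical_points equator fst \<subseteq> (equator :: (real \<times> real \<times> 'a) set)"
      by (auto simp: critical_points_def)
  qed (auto simp: critical_points_equator intro!: continuous_intros)
qed

section \<open>The compactification by the pole\<close>

lemma equator_subset_closure:
  "equator \<subseteq> closure (flatten ` (sphere_graph :: (real \<times> real \<times> 'a::euclidean_space) set))"
proof -
  let ?N = "flatten ` (sphere_graph :: (real \<times> real \<times> 'a) set)"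
  obtain e :: 'a where "e \<in> Basis" using nonempty_Basis by blast
  then have e: "e \<bullet> e = 1" by (simp add: inner_same_Basis)
  let ?s = "\<lambda>t :: real. (t, 0 :: real, sqrt (1 - t * t) *\<^sub>R e)"
  \<comment> \<open>Only the pole needs an argument: it is the limit of a meridian as
    \<open>t\<close> tends to \<open>1\<close>.\<close>
  have "?s ` closure {-1<..<1} \<subseteq> closure ?N"
  proof (rule image_closure_subset)
    have "t * t \<le> 1" if "t \<in> {-1<..<1}" for t :: real
      using that abs_square_le_1[of t] by (auto simp: power2_eq_square)
    then have "?s ` {-1<..<1} \<subseteq> ?N"
      using e unfolding flatten_sphere_graph by (auto simp: equator_def)
    then show "?s ` {-1<..<1} \<subseteq> closure ?N"
      using closure_subset by blast
  qed (auto intro!: continuous_intros)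
  then have "?s 1 \<in> closure ?N"
    by force
  then show ?thesis
    using closure_subset[of ?N] unfolding flatten_sphere_graph by auto
qed

lemma smooth_submanifold_UNIV: "smooth_submanifold DIM('a) (UNIV :: 'a::euclidean_space set)"
  unfolding smooth_submanifold_def
  by (intro ballI exI[of _ UNIV] exI[of _ "\<lambda>x. x"])
     (auto simp: homeomorphism_def intro!: smooth_intros)

lemma smooth_embedding_id: "smooth_embedding (UNIV :: real set) (UNIV :: real set) id"
proof -
  have sm: "smooth_map_on (UNIV :: real set) id"
    using smooth_map_onI[OF smooth_on_ident[OF open_UNIV]] by (metis id_apply subset_UNIV open_UNIV)
  have "inj_on (differential UNIV id p) (tangent_space UNIV p)" for p :: real
    using differential_tangent[OF sm _ has_derivative_id] by (auto intro!: inj_onI)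
  then show ?thesis
    using sm by (simp add: smooth_embedding_def embedding_map_def)
qed

lemma smooth_compactification_sphere_graph:
  "smooth_compactification (sphere_graph :: (real \<times> real \<times> 'a::euclidean_space) set) (UNIV :: real set)
     fst equator (UNIV :: real set) fst flatten id"
proof -
  have "topological_compactification (sphere_graph :: (real \<times> real \<times> 'a) set) (UNIV :: real set)
      fst equator (UNIV :: real set) fst flatten id"
    unfolding topological_compactification_def
    using smooth_embedding_flatten smooth_embedding_id compact_equator connected_equator
      equator_subset_closure
    by (auto simp: smooth_embedding_def flatten_def intro!: continuous_intros)
  then show ?thesis
    unfolding smooth_compactification_def
    using smooth_submanifold_sphere_graph smooth_submanifold_equator smooth_submanifold_UNIV
      smooth_map_on_fst smooth_embedding_flatten smooth_embedding_id by blast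
qed

text \<open>The minimum of the graph flattens to the minimum of the sphere, and the one added point
  is the maximum. Together they are exactly the critical points of the sphere.\<close>

lemma reeb_digraph_equator:
  "reeb_digraph equator fst =
     reeb_DC (sphere_graph :: (real \<times> real \<times> 'a::euclidean_space) set) fst equator fst flatten id"
proof -
  have "equator - flatten ` (sphere_graph :: (real \<times> real \<times> 'a) set) = {(1, 0, 0)}"
    unfolding flatten_sphere_graph by (auto simp: equator_def)
  then show ?thesis
    unfolding reeb_digraph_def reeb_DC_def critical_points_sphere_graph critical_points_equator
    by (simp add: flatten_def insert_commute)
qed

text \<open>Counting vertices suffices: an isomorphism would send the classes of both poles to one
  vertex, so they would coincide, yet the induced function takes the values \<open>-1\<close> and
  \<open>1\<close> on them.\<close>

lemma not_isomorphic_equator_sphere_graph: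
  "\<not> pre_digraph_isomorphic (reeb_digraph (equator :: (real \<times> real \<times> 'a::euclidean_space) set) fst)
     (reeb_digraph (sphere_graph :: (real \<times> real \<times> 'a) set) fst)"
proof
  let ?E = "top_of_set (equator :: (real \<times> real \<times> 'a) set)"
  let ?q = "reeb_quotient ?E fst"
  assume "pre_digraph_isomorphic (reeb_digraph (equator :: (real \<times> real \<times> 'a) set) fst)
     (reeb_digraph (sphere_graph :: (real \<times> real \<times> 'a) set) fst)"
  then obtain h and a :: "(real \<times> real \<times> 'a) set" and G :: "(real \<times> real \<times> 'a) set topology"
    where h: "homeomorphic_map (reeb_space ?E fst) G h"
      "h ` ?q ` {(- 1, 0, 0), (1, 0, 0)} = {a}"
    unfolding reeb_digraph_def critical_points_equator critical_points_sphere_graph by auto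
  have poles: "(- 1, 0, 0 :: 'a) \<in> equator" "(1, 0, 0 :: 'a) \<in> equator"
    by (auto simp: equator_def)
  then have "?q (- 1, 0, 0) \<in> topspace (reeb_space ?E fst)" "?q (1, 0, 0) \<in> topspace (reeb_space ?E fst)"
    using quotient_imp_surjective_map[OF quotient_map_reeb_quotient[of ?E fst]] by auto
  then have "?q (- 1, 0, 0) = ?q (1, 0, 0)"
    using h(2) homeomorphic_imp_injective_map[OF h(1)] by (auto simp: inj_on_def)
  then show False
    using poles reeb_induced_quotient[of "(- 1, 0, 0)" ?E fst]
      reeb_induced_quotient[of "(1, 0, 0)" ?E fst] by simp
qed

theorem theorem2:
  assumes "CARD('m::finite) > 1"
  shows "\<exists>(X1 :: (real \<times> real \<times> (real ^ 'm)) set) (X2 :: (real \<times> real \<times> (real ^ 'm)) set).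
     real_analytic_manifold TYPE(real \<times> real) CARD('m) X1 \<and>
     smooth_submanifold CARD('m) X2 \<and> compact X2 \<and>
     diffeomorphic X1 (UNIV :: (real ^ 'm) set) \<and>
     diffeomorphic X2 (sphere (0 :: real \<times> (real ^ 'm)) 1) \<and>
     reeb_digraph_defined X1 fst \<and>
     reeb_digraph_defined X2 fst \<and>
     (\<exists>\<phi>X. smooth_compactification X1 (UNIV :: real set) fst X2 (UNIV :: real set) fst \<phi>X id \<and>
        reeb_DC_defined X1 fst X2 fst \<phi>X id \<and>
        reeb_digraph X2 fst = reeb_DC X1 fst X2 fst \<phi>X id \<and>
        \<not> pre_digraph_isomorphic (reeb_DC X1 fst X2 fst \<phi>X id) (reeb_digraph X1 fst))"
proof -
  let ?X1 = "sphere_graph :: (real \<times> real \<times> (real ^ 'm)) set"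
  let ?X2 = "equator :: (real \<times> real \<times> (real ^ 'm)) set"
  have "DIM(real ^ 'm) = CARD('m)" by simp
  moreover have defined: "reeb_digraph_defined ?X1 fst" "reeb_digraph_defined ?X2 fst"
    using assms by (auto intro!: reeb_digraph_defined_sphere_graph reeb_digraph_defined_equator)
  moreover have "reeb_DC_defined ?X1 fst ?X2 fst flatten id"
    unfolding reeb_DC_defined_def
    using defined smooth_compactification_sphere_graph[where 'a = "real ^ 'm"]
    by (simp add: smooth_compactification_def reeb_digraph_defined_def reeb_digraph_equator)
  ultimately show ?thesis
    using real_analytic_manifold_sphere_graph[where 'a = "real ^ 'm"]
      smooth_submanifold_equator[where 'a = "real ^ 'm"] compact_equator[where 'a = "real ^ 'm"]
      diffeomorphic_sphere_graph[where 'a = "real ^ 'm"] diffeomorphic_equator[where 'a = "real ^ 'm"]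
      smooth_compactification_sphere_graph[where 'a = "real ^ 'm"]
      reeb_digraph_equator[where 'a = "real ^ 'm"]
      not_isomorphic_equator_sphere_graph[where 'a = "real ^ 'm"]
    by (intro exI[of _ ?X1] exI[of _ ?X2] conjI exI[of _ flatten]) simp_all
qed

end
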